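(* Let $(V,p)$ be an irreducible Markov chain on a finite state space $V$ whose transition function has symmetric support, and let $d$ be a general path distance on $V$ with respect to the induced graph $G$. If $G$ has non-negative Ollivier curvature, then $\beta_1(M_2(G))\le\frac{\deg_{\min}}{2}$.
   Context: A Markov chain $(V,p)$: $p:V\times V\to[0,1]$ with $\sum_y p(x,y)=1$; irreducible; symmetric support: $p(x,y)>0$ iff $p(y,x)>0$. Induced graph: $x\sim y$ iff $x\ne y$ and $p(x,y)>0$; $\deg(x)=|\{y:y\sim x\}|$, $\deg_{\min}=\min_x\deg(x)$. A general path distance is symmetric $d$ with $d(x,y)=0$ iff $x=y$ and $d(x,y)=\inf\{\sum_k d(x_{k-1},x_k):x=x_0\sim\dots\sim x_n=y\}$. Laplacian $\Delta f(x)=\sum_yp(x,y)(f(y)-f(x))$; $\nabla_{xy}f=(f(x)-f(y))/d(x,y)$; $\|\nabla f\|_\infty=\sup_{x\ne y}|\nabla_{xy}f|$; Ollivier curvature $\kappa(x,y)=\inf\{\nabla_{xy}\Delta f:\nabla_{yx}f=1,\|\nabla f\|_\infty=1\}$; non-negative means $\kappa\ge0$ on all edges. $M_2(G)$: 1-forms antisymmetric on ordered adjacent pairs; cycles $(x_0\sim\dots\sim x_{n-1})$ of distinct vertices, $n\ge3$, $x_{n-1}\sim x_0$, up to rotation/reversal; $X_2$ = cycles admitting a labeling with $n=3$, or $d(x_0,x_3)<d(x_0,x_1)+d(x_1,x_2)+d(x_2,x_3)$ and $x_3\sim\dots\sim x_{n-1}\sim x_0$ a geodesic; $\delta\alpha(c)=\sum_i\alpha(x_i,x_{i+1\bmod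 n})$; $\delta_0f(x,y)=f(x)-f(y)$; $\beta_1(M_2(G))=\dim(\ker\delta_1/\operatorname{Im}\delta_0)$ with $\ker\delta_1=\{\alpha:\delta\alpha=0\text{ on }X_2\}$ (equivalently the dimension of $\{\alpha\in\ker\delta_1: \sum_yp(x,y)\alpha(x,y)\text{ constant in }x\}$). *)

theory Defs
  imports "HOL-Analysis.Analysis"
begin

text \<open>The state space is the universe of a type of class \<open>finite\<close>.\<close>

definition markov_chain :: "('a::finite \<Rightarrow> 'a \<Rightarrow> real) \<Rightarrow> bool" where
  "markov_chain p \<longleftrightarrow>
     (\<forall>x y. 0 \<le> p x y \<and> p x y \<le> 1) \<and> (\<forall>x. (\<Sum>y\<in>UNIV. p x y) = 1)"

primrec step_prob :: "('a::finite \<Rightarrow> 'a \<Rightarrow> real) \<Rightarrow> nat \<Rightarrow> 'a \<Rightarrow> 'a \<Rightarrow> real" where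
  "step_prob p 0 x y = (if x = y then 1 else 0)"
| "step_prob p (Suc n) x y = (\<Sum>z\<in>UNIV. p x z * step_prob p n z y)"

definition irreducible_chain :: "('a::finite \<Rightarrow> 'a \<Rightarrow> real) \<Rightarrow> bool" where
  "irreducible_chain p \<longleftrightarrow> (\<forall>x y. \<exists>n. step_prob p n x y > 0)"

definition symmetric_support :: "('a \<Rightarrow> 'a \<Rightarrow> real) \<Rightarrow> bool" where
  "symmetric_support p \<longleftrightarrow> (\<forall>x y. p x y > 0 \<longleftrightarrow> p y x > 0)"

definition adj :: "('a \<Rightarrow> 'a \<Rightarrow> real) \<Rightarrow> 'a \<Rightarrow> 'a \<Rightarrow> bool" where
  "adj p x y \<longleftrightarrow> x \<noteq> y \<and> p x y > 0"

definition vertex_degree :: "('a::finite \<Rightarrow> 'a \<Rightarrow> real) \<Rightarrow> 'a \<Rightarrow> nat" where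
  "vertex_degree p x = card {y. adj p y x}"

definition min_degree :: "('a::finite \<Rightarrow> 'a \<Rightarrow> real) \<Rightarrow> nat" where
  "min_degree p = Min (range (vertex_degree p))"

definition path_length :: "('a \<Rightarrow> 'a \<Rightarrow> real) \<Rightarrow> 'a list \<Rightarrow> real" where
  "path_length d xs = (\<Sum>i<length xs - 1. d (xs ! i) (xs ! Suc i))"

definition paths :: "('a \<Rightarrow> 'a \<Rightarrow> real) \<Rightarrow> 'a \<Rightarrow> 'a \<Rightarrow> 'a list set" where
  "paths p x y = {xs. xs \<noteq> [] \<and> hd xs = x \<and> last xs = y \<and> successively (adj p) xs}"

definition path_distance :: "('a \<Rightarrow> 'a \<Rightarrow> real) \<Rightarrow> ('a \<Rightarrow> 'a \<Rightarrow> real) \<Rightarrow> bool" where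
  "path_distance p d \<longleftrightarrow>
     (\<forall>x y. 0 \<le> d x y) \<and>
     (\<forall>x y. d x y = d y x) \<and>
     (\<forall>x y. d x y = 0 \<longleftrightarrow> x = y) \<and>
     (\<forall>x y. d x y = (INF xs\<in>paths p x y. path_length d xs))"

definition geodesic :: "('a \<Rightarrow> 'a \<Rightarrow> real) \<Rightarrow> ('a \<Rightarrow> 'a \<Rightarrow> real) \<Rightarrow> 'a list \<Rightarrow> bool" where
  "geodesic p d xs \<longleftrightarrow>
     xs \<in> paths p (hd xs) (last xs) \<and> path_length d xs = d (hd xs) (last xs)"

definition laplacian :: "('a::finite \<Rightarrow> 'a \<Rightarrow> real) \<Rightarrow> ('a \<Rightarrow> real) \<Rightarrow> 'a \<Rightarrow> real" where
  "laplacian p f x = (\<Sum>y\<in>UNIV. p x y * (f y - f x))"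

definition grad :: "('a \<Rightarrow> 'a \<Rightarrow> real) \<Rightarrow> 'a \<Rightarrow> 'a \<Rightarrow> ('a \<Rightarrow> real) \<Rightarrow> real" where
  "grad d x y f = (f x - f y) / d x y"

definition grad_norm :: "('a::finite \<Rightarrow> 'a \<Rightarrow> real) \<Rightarrow> ('a \<Rightarrow> real) \<Rightarrow> real" where
  "grad_norm d f = (SUP (x, y)\<in>{(x, y). x \<noteq> y}. \<bar>grad d x y f\<bar>)"

definition ollivier_curvature ::
    "('a::finite \<Rightarrow> 'a \<Rightarrow> real) \<Rightarrow> ('a \<Rightarrow> 'a \<Rightarrow> real) \<Rightarrow> 'a \<Rightarrow> 'a \<Rightarrow> real" where
  "ollivier_curvature p d x y =
     (INF f\<in>{f. grad d y x f = 1 \<and> grad_norm d f = 1}. grad d x y (laplacian p f))"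

definition nonneg_ollivier_curvature ::
    "('a::finite \<Rightarrow> 'a \<Rightarrow> real) \<Rightarrow> ('a \<Rightarrow> 'a \<Rightarrow> real) \<Rightarrow> bool" where
  "nonneg_ollivier_curvature p d \<longleftrightarrow> (\<forall>x y. adj p x y \<longrightarrow> ollivier_curvature p d x y \<ge> 0)"

text \<open>
  A 1-form is an antisymmetric function on the ordered adjacent pairs; it is encoded as a
  matrix by extending it by zero to all other pairs.
\<close>

definition one_forms :: "('a::finite \<Rightarrow> 'a \<Rightarrow> real) \<Rightarrow> (real^'a^'a) set" where
  "one_forms p = {\<alpha>. (\<forall>x y. \<alpha> $ x $ y = - \<alpha> $ y $ x) \<and> (\<forall>x y. \<not> adj p x y \<longrightarrow> \<alpha> $ x $ y = 0)}"

definition delta0 :: "('a::finite \<Rightarrow> 'a \<Rightarrow> real) \<Rightarrow> ('a \<Rightarrow> real) \<Rightarrow> real^'a^'a" where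
  "delta0 p f = (\<chi> x y. if adj p x y then f x - f y else 0)"

text \<open>
  A cycle is given by a labelling, i.e. by the list of its vertices. Two lists label the same
  cycle iff they agree up to rotation and reversal.
\<close>

definition is_cycle :: "('a \<Rightarrow> 'a \<Rightarrow> real) \<Rightarrow> 'a list \<Rightarrow> bool" where
  "is_cycle p xs \<longleftrightarrow>
     length xs \<ge> 3 \<and> distinct xs \<and>
     (\<forall>i<length xs. adj p (xs ! i) (xs ! (Suc i mod length xs)))"

definition same_cycle :: "'a list \<Rightarrow> 'a list \<Rightarrow> bool" where
  "same_cycle xs ys \<longleftrightarrow> (\<exists>k. ys = rotate k xs \<or> ys = rotate k (rev xs))"

text \<open>
  \<open>X2\<close> contains all labellings of each of its cycles. As \<open>\<alpha>\<close> is antisymmetric, the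
  labelling affects \<open>delta1 \<alpha>\<close> only by a sign, so the kernel below does not depend on it.
\<close>

definition X2 :: "('a \<Rightarrow> 'a \<Rightarrow> real) \<Rightarrow> ('a \<Rightarrow> 'a \<Rightarrow> real) \<Rightarrow> 'a list set" where
  "X2 p d = {c. is_cycle p c \<and> (\<exists>xs. same_cycle c xs \<and>
     (length xs = 3 \<or>
      length xs > 3 \<and>
      d (xs ! 0) (xs ! 3) < d (xs ! 0) (xs ! 1) + d (xs ! 1) (xs ! 2) + d (xs ! 2) (xs ! 3) \<and>
      geodesic p d (drop 3 xs @ [xs ! 0])))}"

definition delta1 :: "real^'a^'a \<Rightarrow> 'a::finite list \<Rightarrow> real" where
  "delta1 \<alpha> xs = (\<Sum>i<length xs. \<alpha> $ (xs ! i) $ (xs ! (Suc i mod length xs)))"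

definition ker_delta1 ::
    "('a::finite \<Rightarrow> 'a \<Rightarrow> real) \<Rightarrow> ('a \<Rightarrow> 'a \<Rightarrow> real) \<Rightarrow> (real^'a^'a) set" where
  "ker_delta1 p d = {\<alpha> \<in> one_forms p. \<forall>c\<in>X2 p d. delta1 \<alpha> c = 0}"

text \<open>
  \<open>B\<close> consists of representatives of a basis of the quotient space \<open>U / W\<close>: a linear
  combination of cosets vanishes in the quotient iff its representative lies in \<open>W\<close>.
\<close>

definition quotient_basis :: "'v::real_vector set \<Rightarrow> 'v set \<Rightarrow> 'v set \<Rightarrow> bool" where
  "quotient_basis U W B \<longleftrightarrow>
     finite B \<and> B \<subseteq> U \<and>
     (\<forall>c. (\<Sum>b\<in>B. c b *\<^sub>R b) \<in> W \<longrightarrow> (\<forall>b\<in>B. c b = 0)) \<and>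
     (\<forall>u\<in>U. \<exists>c. u - (\<Sum>b\<in>B. c b *\<^sub>R b) \<in> W)"

definition quotient_dim :: "'v::real_vector set \<Rightarrow> 'v set \<Rightarrow> nat" where
  "quotient_dim U W = (THE n. \<exists>B. quotient_basis U W B \<and> card B = n)"

definition betti1 :: "('a::finite \<Rightarrow> 'a \<Rightarrow> real) \<Rightarrow> ('a \<Rightarrow> 'a \<Rightarrow> real) \<Rightarrow> nat" where
  "betti1 p d = quotient_dim (ker_delta1 p d) (range (delta0 p))"


lemma quotient_basis_card:
  fixes U W :: "'v::euclidean_space set"
  assumes U: "subspace U" and W: "subspace W" and WU: "W \<subseteq> U" and B: "quotient_basis U W B"
  shows "card B + dim W = dim U"
proof -
  have fin: "finite B" and BU: "B \<subseteq> U"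
    and ind: "\<And>c. (\<Sum>b\<in>B. c b *\<^sub>R b) \<in> W \<Longrightarrow> \<forall>b\<in>B. c b = 0"
    and spn: "\<And>u. u \<in> U \<Longrightarrow> \<exists>c. u - (\<Sum>b\<in>B. c b *\<^sub>R b) \<in> W"
    using B by (auto simp: quotient_basis_def)
  have indB: "independent B"
  proof -
    have "\<forall>b\<in>B. c b = 0" if "(\<Sum>b\<in>B. c b *\<^sub>R b) = 0" for c
      using ind[of c] that subspace_0[OF W] by simp
    then show ?thesis using fin by (auto simp: dependent_finite)
  qed
  have int: "span B \<inter> W = {0}"
  proof -
    have "w = 0" if w: "w \<in> span B" "w \<in> W" for w
    proof -
      obtain c where c: "w = (\<Sum>b\<in>B. c b *\<^sub>R b)" using w(1) span_finite[OF fin] by auto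
      then show ?thesis using ind[of c] w(2) by simp
    qed
    then show ?thesis using subspace_0[OF W] span_zero by blast
  qed
  have sum: "{x + y |x y. x \<in> span B \<and> y \<in> W} = U"
  proof (intro equalityI subsetI)
    fix u assume "u \<in> {x + y |x y. x \<in> span B \<and> y \<in> W}"
    then show "u \<in> U" using span_minimal[OF BU U] WU subspace_add[OF U] by blast
  next
    fix u assume "u \<in> U"
    then obtain c where c: "u - (\<Sum>b\<in>B. c b *\<^sub>R b) \<in> W" using spn by blast
    moreover have "(\<Sum>b\<in>B. c b *\<^sub>R b) \<in> span B"
      by (intro span_sum span_scale span_base)
    ultimately show "u \<in> {x + y |x y. x \<in> span B \<and> y \<in> W}"
      by (intro CollectI exI[of _ "\<Sum>b\<in>B. c b *\<^sub>R b"] exI[of _ "u - (\<Sum>b\<in>B. c b *\<^sub>R b)"]) simp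
  qed
  show ?thesis
    using dim_sums_Int[OF subspace_span[of B] W] int sum indB by (simp add: dim_eq_card_independent)
qed

lemma quotient_basis_exists:
  fixes U W :: "'v::euclidean_space set"
  assumes U: "subspace U" and W: "subspace W" and WU: "W \<subseteq> U"
  shows "\<exists>B. quotient_basis U W B"
proof -
  define C where "C = {u \<in> U. \<forall>w\<in>W. orthogonal u w}"
  have CU: "C \<subseteq> U" by (auto simp: C_def)
  have C: "subspace C"
    using U by (auto simp: C_def subspace_def orthogonal_clauses)
  obtain B where B: "B \<subseteq> C" "independent B" "C \<subseteq> span B" "card B = dim C"
    using basis_exists by blast
  have fin: "finite B" using B(2) by (rule independent_imp_finite)
  have ind: "\<forall>b\<in>B. c b = 0" if "(\<Sum>b\<in>B. c b *\<^sub>R b) \<in> W" for c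
  proof -
    have "(\<Sum>b\<in>B. c b *\<^sub>R b) \<in> C"
      using B(1) by (intro subspace_sum[OF C] subspace_scale[OF C]) auto
    then have "(\<Sum>b\<in>B. c b *\<^sub>R b) = 0" using that by (auto simp: C_def orthogonal_self)
    then show ?thesis using B(2) fin by (auto simp: dependent_finite)
  qed
  have spn: "\<exists>c. u - (\<Sum>b\<in>B. c b *\<^sub>R b) \<in> W" if u: "u \<in> U" for u
  proof -
    obtain y z where yz: "y \<in> span W" "\<And>w. w \<in> span W \<Longrightarrow> orthogonal z w" "u = y + z"
      using orthogonal_subspace_decomp_exists[of W u] by blast
    have y: "y \<in> W" using yz(1) W by (metis span_eq_iff)
    have "z = u - y" using yz(3) by simp
    then have "z \<in> U" using subspace_diff[OF U u] y WU by auto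
    then have "z \<in> C" using yz(2) by (auto simp: C_def span_base)
    then obtain c where "z = (\<Sum>b\<in>B. c b *\<^sub>R b)" using B(3) span_finite[OF fin] by auto
    then show ?thesis using yz(3) y by (intro exI[of _ c]) simp
  qed
  have "B \<subseteq> U" using B(1) CU by simp
  with fin ind spn have "quotient_basis U W B" by (simp add: quotient_basis_def)
  then show ?thesis ..
qed

lemma quotient_dim_eq:
  fixes U W :: "'v::euclidean_space set"
  assumes "subspace U" "subspace W" "W \<subseteq> U"
  shows "quotient_dim U W = dim U - dim W"
proof -
  obtain B where B: "quotient_basis U W B" using quotient_basis_exists[OF assms] by blast
  have "quotient_dim U W = card B" unfolding quotient_dim_def
  proof (rule the_equality)
    fix n assume "\<exists>B. quotient_basis U W B \<and> card B = n"
    then obtain B' where "quotient_basis U W B'" "card B' = n" by blast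
    then show "n = card B"
      using quotient_basis_card[OF assms, of B'] quotient_basis_card[OF assms B] by simp
  qed (use B in blast)
  then show ?thesis using quotient_basis_card[OF assms B] by simp
qed

lemma subspace_one_forms: "subspace (one_forms p)"
proof -
  have "\<alpha> + \<beta> \<in> one_forms p" if "\<alpha> \<in> one_forms p" "\<beta> \<in> one_forms p" for \<alpha> \<beta>
    unfolding one_forms_def
  proof (intro CollectI conjI allI impI)
    fix x y
    have "\<alpha> $ x $ y = - \<alpha> $ y $ x" "\<beta> $ x $ y = - \<beta> $ y $ x"
      using that unfolding one_forms_def by blast+
    then show "(\<alpha> + \<beta>) $ x $ y = - (\<alpha> + \<beta>) $ y $ x" by simp
  next
    fix x y assume "\<not> adj p x y"
    then have "\<alpha> $ x $ y = 0" "\<beta> $ x $ y = 0" using that unfolding one_forms_def by blast+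
    then show "(\<alpha> + \<beta>) $ x $ y = 0" by simp
  qed
  moreover have "c *\<^sub>R \<alpha> \<in> one_forms p" if "\<alpha> \<in> one_forms p" for c \<alpha>
    unfolding one_forms_def
  proof (intro CollectI conjI allI impI)
    fix x y
    have "\<alpha> $ x $ y = - \<alpha> $ y $ x" using that unfolding one_forms_def by blast
    then show "(c *\<^sub>R \<alpha>) $ x $ y = - (c *\<^sub>R \<alpha>) $ y $ x" by simp
  next
    fix x y assume "\<not> adj p x y"
    then have "\<alpha> $ x $ y = 0" using that unfolding one_forms_def by blast
    then show "(c *\<^sub>R \<alpha>) $ x $ y = 0" by simp
  qed
  moreover have "0 \<in> one_forms p" by (simp add: one_forms_def)
  ultimately show ?thesis by (simp add: subspace_def)
qed

lemma subspace_ker_delta1: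
  fixes p d :: "'a::finite \<Rightarrow> 'a \<Rightarrow> real"
  shows "subspace (ker_delta1 p d)"
proof -
  have "delta1 (\<alpha> + \<beta>) c = delta1 \<alpha> c + delta1 \<beta> c" for \<alpha> \<beta> :: "real^'a^'a" and c
    by (simp add: delta1_def sum.distrib)
  moreover have "delta1 (r *\<^sub>R \<alpha>) c = r * delta1 \<alpha> c" for r and \<alpha> :: "real^'a^'a" and c
    by (simp add: delta1_def sum_distrib_left)
  moreover have "delta1 (0 :: real^'a^'a) c = 0" for c by (simp add: delta1_def)
  ultimately show ?thesis using subspace_one_forms[of p] by (simp add: ker_delta1_def subspace_def)
qed

lemma subspace_range_delta0: "subspace (range (delta0 p))"
proof -
  have "delta0 p f + delta0 p g = delta0 p (\<lambda>x. f x + g x)" for f g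
    by (auto simp: delta0_def vec_eq_iff)
  moreover have "c *\<^sub>R delta0 p f = delta0 p (\<lambda>x. c * f x)" for c f
    by (auto simp: delta0_def vec_eq_iff algebra_simps)
  moreover have "0 = delta0 p (\<lambda>x. 0)" by (auto simp: delta0_def vec_eq_iff)
  ultimately show ?thesis unfolding subspace_def by (auto intro: range_eqI)
qed

lemma range_delta0_subset:
  assumes "symmetric_support p"
  shows "range (delta0 p) \<subseteq> ker_delta1 p d"
proof -
  have "delta1 (delta0 p f) c = 0" if c: "is_cycle p c" for f c
  proof -
    let ?n = "length c"
    have n: "?n > 0" using c by (auto simp: is_cycle_def)
    have "delta1 (delta0 p f) c = (\<Sum>i<?n. f (c ! i) - f (c ! (Suc i mod ?n)))"
      unfolding delta1_def by (rule sum.cong) (use c in \<open>auto simp: is_cycle_def delta0_def\<close>)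
    also have "\<dots> = (\<Sum>i<?n. f (c ! (i mod ?n)) - f (c ! (Suc i mod ?n)))"
      by (rule sum.cong) auto
    also have "\<dots> = 0" using sum_lessThan_telescope'[of "\<lambda>i. f (c ! (i mod ?n))" ?n] n by simp
    finally show ?thesis .
  qed
  moreover have "delta0 p f \<in> one_forms p" for f
    using assms by (auto simp: one_forms_def delta0_def adj_def symmetric_support_def)
  ultimately show ?thesis by (auto simp: ker_delta1_def X2_def)
qed

lemma betti1_eq_dim_diff:
  assumes "symmetric_support p"
  shows "betti1 p d = dim (ker_delta1 p d) - dim (range (delta0 p))"
  unfolding betti1_def
  by (intro quotient_dim_eq subspace_ker_delta1 subspace_range_delta0 range_delta0_subset assms)

end

theory Submission
  imports Defs
begin

text \<open>
  By rank-nullity, the Betti number is at most the dimension of the space of forms in the kernel of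
  \<open>\<delta>\<^sub>1\<close> with constant divergence. Scale such a form to have maximal slope \<open>1\<close>, and call an
  edge tight if it attains this slope. The cycles in \<open>X2\<close> are exactly what makes the local primitive
  of the form near an edge 1-Lipschitz, so that non-negative curvature applies to it; constancy of
  the divergence then forces equality. Hence the lazy walks started at the two ends of a tight path
  can be coupled such that they remain joined by tight paths or merge, and the expected length of
  these paths is constant.
  If some vertex were not the start of a tight edge, the walk would hit it, and merge there, before
  time \<open>n\<close> with probability exponentially close to one, while path lengths grow at most linearly;
  a contradiction.

  So the maximal slope is attained at every vertex, for the form and its negative alike. The
  slopes at a vertex of minimal degree thus span a centrally symmetric polytope of full dimension in
  the dual space, which has at least two vertices per dimension.
\<close>

section \<open>Paths and cycles as lists\<close>

lemma path_length_singleton [simp]: "path_length f [x] = 0"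
  by (simp add: path_length_def)

lemma path_length_Cons [simp]: "path_length f (x # y # xs) = f x y + path_length f (y # xs)"
  by (simp add: path_length_def sum.lessThan_Suc_shift del: sum.lessThan_Suc)

text \<open>The weight \<open>f\<close> is arbitrary: the same rule serves for lengths, with
  \<open>f = d\<close>, and for sums of a 1-form along a path.\<close>

lemma path_length_append:
  "path_length f (xs @ v # ys) = path_length f (xs @ [v]) + path_length f (v # ys)"
proof (induction xs)
  case (Cons x xs)
  then show ?case by (cases xs) auto
qed simp

lemma path_endsE:
  assumes "g \<in> paths p x y"
  obtains "hd g = x" "last g = y" "g = butlast g @ [y]" "g = x # tl g"
  using assms by (cases g) (auto simp: paths_def)

lemma successively_append_Cons_iff:
  "successively P (xs @ v # ys) \<longleftrightarrow> successively P (xs @ [v]) \<and> successively P (v # ys)"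
  by (induction xs rule: induct_list012) auto

lemma hd_append_Cons: "hd (xs @ v # ys) = hd (xs @ [v])"
  by (cases xs) auto

lemma paths_append_Cons_iff:
  "xs @ v # ys \<in> paths p x y \<longleftrightarrow> xs @ [v] \<in> paths p x v \<and> v # ys \<in> paths p v y"
  using successively_append_Cons_iff[of "adj p" xs v ys] hd_append_Cons[of xs v ys]
  by (auto simp: paths_def)

lemma delta1_eq_path_length:
  assumes "c \<noteq> []"
  shows "delta1 \<alpha> c = path_length (\<lambda>u v. \<alpha> $ u $ v) (c @ [hd c])"
proof -
  have "(c @ [hd c]) ! Suc i = c ! (Suc i mod length c)" if "i < length c" for i
    using that assms by (cases "Suc i = length c") (auto simp: nth_append hd_conv_nth)
  then show ?thesis
    by (auto simp: delta1_def path_length_def nth_append intro!: sum.cong)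
qed

lemma same_cycle_refl: "same_cycle c c"
  unfolding same_cycle_def by (rule exI[of _ 0]) simp

lemma is_cycleI:
  assumes "length c \<ge> 3" "distinct c" "successively (adj p) (c @ [hd c])"
  shows "is_cycle p c"
proof -
  have "c \<noteq> []" using assms(1) by auto
  then have eq: "(c @ [hd c]) ! Suc i = c ! (Suc i mod length c)" if "i < length c" for i
    using that by (cases "Suc i = length c") (auto simp: nth_append hd_conv_nth)
  have "adj p (c ! i) (c ! (Suc i mod length c))" if "i < length c" for i
    using successively_nth[OF assms(3), of i] eq[OF that] that by (auto simp: nth_append)
  then show ?thesis using assms by (auto simp: is_cycle_def)
qed

subsection \<open>Geodesics\<close>

locale path_metric =
  fixes p d :: "'a::finite \<Rightarrow> 'a \<Rightarrow> real"
  assumes markov: "markov_chain p"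
    and irred: "irreducible_chain p"
    and symm: "symmetric_support p"
    and pdist: "path_distance p d"
begin

lemma p_nonneg: "0 \<le> p x y" and p_sum: "(\<Sum>y\<in>UNIV. p x y) = 1"
  using markov by (auto simp: markov_chain_def)

lemma d_nonneg: "0 \<le> d x y" and d_sym: "d x y = d y x" and d_eq_0: "d x y = 0 \<longleftrightarrow> x = y"
  and d_INF: "d x y = (INF xs\<in>paths p x y. path_length d xs)"
  using pdist by (auto simp: path_distance_def)

lemma d_pos: "x \<noteq> y \<Longrightarrow> 0 < d x y"
  using d_nonneg[of x y] d_eq_0[of x y] by linarith

lemma d_self [simp]: "d x x = 0" by (simp add: d_eq_0)

lemma adj_sym: "adj p x y \<Longrightarrow> adj p y x"
  using symm by (auto simp: adj_def symmetric_support_def)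

lemma adj_irrefl [simp]: "\<not> adj p x x"
  by (auto simp: adj_def)

lemma step_prob_nonneg: "0 \<le> step_prob p n x y"
  by (induction n arbitrary: x) (auto intro!: sum_nonneg mult_nonneg_nonneg p_nonneg)

lemma step_prob_SucE:
  assumes "step_prob p (Suc n) x y > 0"
  obtains z where "p x z > 0" "step_prob p n z y > 0"
proof -
  have "\<exists>z. p x z * step_prob p n z y > 0"
  proof (rule ccontr)
    assume "\<not> ?thesis"
    then have "step_prob p (Suc n) x y \<le> 0" by (auto intro!: sum_nonpos simp: not_less)
    then show False using assms by simp
  qed
  then show ?thesis
    using that p_nonneg step_prob_nonneg by (metis less_eq_real_def mult_zero_left mult_zero_right)
qed

text \<open>Connectedness of the induced graph as an induction rule. A step of positive probability
  that is not an edge is a loop and does not leave \<open>A\<close>.\<close>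

lemma adj_closed_UNIV:
  assumes "x \<in> A" "\<And>u v. u \<in> A \<Longrightarrow> adj p u v \<Longrightarrow> v \<in> A"
  shows "y \<in> A"
proof -
  have "x \<in> A \<Longrightarrow> step_prob p n x y > 0 \<Longrightarrow> y \<in> A" for n x
  proof (induction n arbitrary: x)
    case 0
    then show ?case by (auto split: if_splits)
  next
    case (Suc n)
    then obtain z where z: "p x z > 0" "step_prob p n z y > 0" by (metis step_prob_SucE)
    have "z \<in> A" using Suc.prems(1) z(1) assms(2)[of x z] by (cases "z = x") (auto simp: adj_def)
    then show ?case using Suc.IH z(2) by blast
  qed
  then show ?thesis using assms(1) irred unfolding irreducible_chain_def by blast
qed

lemma paths_nonempty: "paths p x y \<noteq> {}"
proof -
  have "y \<in> {y. paths p x y \<noteq> {}}"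
  proof (rule adj_closed_UNIV[of x])
    show "x \<in> {y. paths p x y \<noteq> {}}" by (auto simp: paths_def intro!: exI[of _ "[x]"])
    fix u v assume "u \<in> {y. paths p x y \<noteq> {}}" "adj p u v"
    then obtain xs where "xs \<in> paths p x u" "adj p u v" by auto
    then have "xs @ [v] \<in> paths p x v" by (auto simp: paths_def successively_append_iff)
    then show "v \<in> {y. paths p x y \<noteq> {}}" by auto
  qed
  then show ?thesis by simp
qed

lemma path_length_nonneg: "0 \<le> path_length d xs"
  by (auto simp: path_length_def intro!: sum_nonneg d_nonneg)

lemma d_le_path_length: "xs \<in> paths p x y \<Longrightarrow> d x y \<le> path_length d xs"
  unfolding d_INF[of x y]
  by (rule cINF_lower) (auto intro!: bdd_belowI[of _ 0] path_length_nonneg)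

lemma edge_length_lower_bound:
  obtains e where "e > 0" "\<And>xs. successively (adj p) xs \<Longrightarrow> e * real (length xs - 1) \<le> path_length d xs"
proof
  define e where "e = Min (insert 1 {d u v |u v. u \<noteq> v})"
  have fin: "finite {d u v |u v. u \<noteq> v}"
    by (rule finite_subset[of _ "case_prod d ` UNIV"]) auto
  show "e > 0" using fin unfolding e_def by (subst Min_gr_iff) (auto intro: d_pos)
  have le: "e \<le> d u v" if "u \<noteq> v" for u v
    using fin that unfolding e_def by (intro Min_le) auto
  show "e * real (length xs - 1) \<le> path_length d xs" if "successively (adj p) xs" for xs
    using that
  proof (induction xs rule: induct_list012)
    case (3 x y zs)
    then have "e \<le> d x y" using le by (auto simp: adj_def)
    then show ?case using 3 by (auto simp: algebra_simps)
  qed (auto simp: path_length_def)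
qed

text \<open>Edge lengths are bounded below, so the paths no longer than a fixed one have boundedly
  many vertices. Finitely many candidates remain, and the infimum is attained.\<close>

lemma shortest_path_exists: "\<exists>g\<in>paths p x y. path_length d g = d x y"
proof -
  obtain e where e: "e > 0" "\<And>xs. successively (adj p) xs \<Longrightarrow> e * real (length xs - 1) \<le> path_length d xs"
    using edge_length_lower_bound by blast
  obtain q where q: "q \<in> paths p x y" using paths_nonempty[of x y] by auto
  define Q where "Q = {xs \<in> paths p x y. path_length d xs \<le> path_length d q}"
  obtain N :: nat where N: "path_length d q / e < N" using reals_Archimedean2 by blast
  have "length xs \<le> Suc N" if "xs \<in> Q" for xs
  proof -
    have "e * real (length xs - 1) \<le> path_length d q"
      using that e(2)[of xs] by (auto simp: Q_def paths_def)
    also have "\<dots> < e * N" using N e(1) by (simp add: field_simps)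
    finally show ?thesis using e(1) by simp
  qed
  then have "Q \<subseteq> {xs. set xs \<subseteq> UNIV \<and> length xs \<le> Suc N}" by auto
  then have finQ: "finite Q"
    by (rule finite_subset) (rule finite_lists_length_le[OF finite])
  have "Q \<noteq> {}" using q by (auto simp: Q_def)
  then obtain g where g: "g \<in> Q" "\<And>xs. xs \<in> Q \<Longrightarrow> path_length d g \<le> path_length d xs"
    using finQ by (metis arg_min_if_finite(1) arg_min_least)
  have min: "path_length d g \<le> path_length d xs" if "xs \<in> paths p x y" for xs
    using that g by (cases "xs \<in> Q") (fastforce simp: Q_def)+
  have "path_length d g \<le> d x y"
    unfolding d_INF[of x y] by (rule cINF_greatest) (use paths_nonempty min in auto)
  then show ?thesis using g(1) d_le_path_length[of g x y] by (auto simp: Q_def intro!: bexI[of _ g])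
qed

definition geo :: "'a \<Rightarrow> 'a \<Rightarrow> 'a list \<Rightarrow> bool" where
  "geo x y g \<longleftrightarrow> g \<in> paths p x y \<and> path_length d g = d x y"

lemma geodesic_if_geo: "geo x y g \<Longrightarrow> geodesic p d g"
  by (auto simp: geo_def geodesic_def paths_def)

lemma geo_exists: "\<exists>g. geo x y g"
  using shortest_path_exists by (auto simp: geo_def)

lemma geo_refl: "geo x x [x]"
  by (auto simp: geo_def paths_def)

lemma geo_edge: "adj p x y \<Longrightarrow> geo x y [x, y]"
  by (auto simp: geo_def paths_def)

lemma geo_concat:
  assumes "geo x v (xs @ [v])" "geo v y (v # ys)" "d x v + d v y \<le> d x y"
  shows "geo x y (xs @ v # ys)"
  using assms d_le_path_length[of "xs @ v # ys" x y]
  by (auto simp: geo_def paths_append_Cons_iff[of xs v ys p x y] path_length_append[of d xs v ys])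

lemma d_triangle: "d x z \<le> d x y + d y z"
proof -
  obtain g h where g: "geo x y g" and h: "geo y z h" using geo_exists by blast
  then obtain g' h' where eq: "g = g' @ [y]" "h = y # h'"
    by (metis geo_def path_endsE)
  have "d x z \<le> path_length d (g' @ y # h')"
    using g h eq paths_append_Cons_iff[of g' y h' p x z]
    by (intro d_le_path_length) (auto simp: geo_def)
  then show ?thesis using g h eq by (auto simp: geo_def path_length_append[of d g' y h'])
qed

lemma geo_split:
  assumes "geo x y (xs @ v # ys)"
  shows "geo x v (xs @ [v])" "geo v y (v # ys)" "d x v + d v y = d x y"
proof -
  have "xs @ v # ys \<in> paths p x y" using assms by (simp add: geo_def)
  then have P: "xs @ [v] \<in> paths p x v" "v # ys \<in> paths p v y"
    by (simp_all only: paths_append_Cons_iff[of xs v ys p x y])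
  have "d x v \<le> path_length d (xs @ [v])" "d v y \<le> path_length d (v # ys)"
    using P by (auto intro: d_le_path_length)
  moreover have "path_length d (xs @ [v]) + path_length d (v # ys) = d x y"
    using assms by (simp add: geo_def path_length_append[of d xs v ys])
  ultimately show "geo x v (xs @ [v])" "geo v y (v # ys)" "d x v + d v y = d x y"
    using P d_triangle[of x y v] by (auto simp: geo_def)
qed

lemma geo_through: "geo x y g \<Longrightarrow> v \<in> set g \<Longrightarrow> d x v + d v y = d x y"
  by (metis geo_split(3) split_list)

text \<open>A repeated vertex \<open>v\<close> would leave a geodesic from \<open>v\<close> to
  itself, of length zero although its second vertex is adjacent to \<open>v\<close>.\<close>

lemma geo_distinct:
  assumes "geo x y g"
  shows "distinct g"
proof (rule ccontr)
  assume "\<not> distinct g"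
  then obtain xs ys zs v where g: "g = xs @ [v] @ ys @ [v] @ zs" using not_distinct_decomp by blast
  define u where "u = hd (ys @ [v])"
  have "geo v y (v # ys @ v # zs)" using geo_split(2)[of x y xs v "ys @ v # zs"] assms g by simp
  then have loop: "geo v v (v # ys @ [v])" using geo_split(1)[of v y "v # ys" v zs] by simp
  have "u \<in> set (v # ys @ [v])" unfolding u_def by (cases ys) auto
  then have "d v u + d u v = 0" using geo_through[OF loop, of u] by simp
  then have "u = v" using d_nonneg[of v u] d_nonneg[of u v] d_eq_0[of v u] by auto
  moreover have "adj p v u" using loop by (cases ys) (auto simp: geo_def paths_def u_def)
  ultimately show False by simp
qed

definition diam :: real where
  "diam = Max (range (case_prod d))"

lemma d_le_diam: "d x y \<le> diam"
  unfolding diam_def using Max_ge[OF finite_imageI[OF finite] rangeI, of "case_prod d" "(x, y)"] by simp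

section \<open>The lazy walk and its exit from a set\<close>

definition nbhd :: "'a \<Rightarrow> 'a set" where
  "nbhd x = {v. v = x \<or> adj p x v}"

text \<open>
  Laziness is harmless, as the curvature depends on \<open>p\<close> only through the Laplacian, which the lazy
  walk just halves.
\<close>

definition mean :: "'a \<Rightarrow> ('a \<Rightarrow> real) \<Rightarrow> real" where
  "mean x f = ((\<Sum>v\<in>UNIV. p x v * f v) + f x) / 2"

lemma mean_mono:
  assumes "\<And>v. v \<in> nbhd x \<Longrightarrow> f v \<le> g v"
  shows "mean x f \<le> mean x g"
proof -
  have "p x v * f v \<le> p x v * g v" for v
    using assms[of v] p_nonneg[of x v]
    by (cases "p x v = 0") (auto simp: nbhd_def adj_def intro!: mult_left_mono)
  then have "(\<Sum>v\<in>UNIV. p x v * f v) \<le> (\<Sum>v\<in>UNIV. p x v * g v)" by (intro sum_mono)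
  moreover have "f x \<le> g x" using assms by (simp add: nbhd_def)
  ultimately show ?thesis by (simp add: mean_def)
qed

lemma mean_add: "mean x (\<lambda>v. f v + g v) = mean x f + mean x g"
  by (simp add: mean_def distrib_left sum.distrib add_divide_distrib)

lemma mean_scale: "mean x (\<lambda>v. c * f v) = c * mean x f"
  by (simp add: mean_def sum_distrib_left algebra_simps)

lemma mean_const: "mean x (\<lambda>v. c) = c"
  by (simp add: mean_def p_sum flip: sum_distrib_right)

text \<open>A Lyapunov function for the walk killed outside \<open>T\<close>. From each vertex of
  \<open>T\<close>, a step of probability at least \<open>m\<close> lowers the number
  \<open>k\<close> of steps to the complement. As \<open>e < m\<close>, the mean of
  \<open>e ^ k\<close> after one step exceeds its present value, so \<open>h\<close> decreases in
  mean; finiteness makes the rate uniform.\<close>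

lemma strict_supersolution_exists:
  assumes "T \<noteq> UNIV"
  shows "\<exists>h \<rho>. 0 \<le> \<rho> \<and> \<rho> < 1 \<and> (\<forall>x. 0 \<le> h x) \<and> (\<forall>x\<in>T. 1 \<le> h x) \<and> (\<forall>x\<in>T. mean x h \<le> \<rho> * h x)"
proof -
  define k where "k x = (LEAST n. \<exists>v. v \<notin> T \<and> step_prob p n x v > 0)" for x
  define m where "m = Min (insert 1 {p u v |u v. p u v > 0})"
  have fin: "finite {p u v |u v. p u v > 0}"
    by (rule finite_subset[of _ "case_prod p ` UNIV"]) auto
  have m: "0 < m" "m \<le> 1" "\<And>u v. p u v > 0 \<Longrightarrow> m \<le> p u v"
  proof -
    show "0 < m" using fin unfolding m_def by (subst Min_gr_iff) auto
    show "m \<le> 1" using fin unfolding m_def by (intro Min_le) auto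
    show "m \<le> p u v" if "p u v > 0" for u v using fin that unfolding m_def by (intro Min_le) auto
  qed
  \<comment> \<open>Besides \<open>e < m\<close>, this ensures \<open>e \<le> 1 / 2\<close>, whence
    \<open>1 \<le> h x\<close> as soon as \<open>1 \<le> k x\<close>.\<close>
  define e where "e = m / 2"
  have e: "0 < e" "e \<le> 1 / 2" "e < m" using m by (auto simp: e_def)
  define h where "h x = 2 * (1 - e ^ k x)" for x
  have pow: "0 \<le> e ^ n" "e ^ n \<le> 1" for n using e by (auto intro: power_le_one)
  have step: "1 \<le> h x \<and> mean x h < h x" if x: "x \<in> T" for x
  proof -
    have ex: "\<exists>n v. v \<notin> T \<and> step_prob p n x v > 0"
      using assms irred unfolding irreducible_chain_def by blast
    then obtain v where v: "v \<notin> T" "step_prob p (k x) x v > 0"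
      unfolding k_def using LeastI_ex[OF ex] by blast
    then obtain j where j: "k x = Suc j" using x by (cases "k x") (auto split: if_splits)
    then obtain z where z: "p x z > 0" "step_prob p j z v > 0" using v step_prob_SucE by metis
    have kz: "k z \<le> j" unfolding k_def using z(2) v(1) by (intro Least_le) auto
    have "e ^ Suc j < m * e ^ j" using e by simp
    also have "\<dots> \<le> p x z * e ^ k z"
      using m(3)[OF z(1)] kz e p_nonneg by (intro mult_mono power_decreasing) auto
    also have "\<dots> \<le> (\<Sum>u\<in>UNIV. p x u * e ^ k u)"
      using e p_nonneg by (intro member_le_sum) auto
    finally have "e ^ k x < (\<Sum>u\<in>UNIV. p x u * e ^ k u)" using j by simp
    moreover have "(\<Sum>u\<in>UNIV. p x u * h u) = 2 - 2 * (\<Sum>u\<in>UNIV. p x u * e ^ k u)"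
    proof -
      have "(\<Sum>u\<in>UNIV. p x u * h u) = (\<Sum>u\<in>UNIV. 2 * p x u - 2 * (p x u * e ^ k u))"
        by (intro sum.cong) (auto simp: h_def algebra_simps)
      then show ?thesis by (simp add: sum_subtractf p_sum flip: sum_distrib_left)
    qed
    ultimately have "mean x h < h x" by (simp add: mean_def h_def)
    moreover have "e ^ k x \<le> e" using j pow e by (simp add: mult_left_le)
    ultimately show ?thesis using e by (simp add: h_def)
  qed
  define \<rho> where "\<rho> = Max (insert 0 ((\<lambda>x. mean x h / h x) ` T))"
  have "0 \<le> \<rho>" unfolding \<rho>_def by (intro Max_ge) auto
  moreover have "\<rho> < 1" unfolding \<rho>_def using step by (subst Max_less_iff) (fastforce simp: divide_less_eq)+
  moreover have "mean x h \<le> \<rho> * h x" if "x \<in> T" for x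
  proof -
    have "mean x h / h x \<le> \<rho>" unfolding \<rho>_def using that by (intro Max_ge) auto
    then show ?thesis using step[OF that] by (simp add: pos_divide_le_eq)
  qed
  ultimately show ?thesis
    using step pow by (intro exI[of _ h] exI[of _ \<rho>]) (auto simp: h_def)
qed

end

subsection \<open>Primitives near an edge\<close>

locale closed_form = path_metric p d for p d :: "'a::finite \<Rightarrow> 'a \<Rightarrow> real" +
  fixes A :: "'a \<Rightarrow> 'a \<Rightarrow> real"
  assumes A_anti: "A x y = - A y x"
    and A_nonadj: "\<not> adj p x y \<Longrightarrow> A x y = 0"
    and A_cycle: "c \<in> X2 p d \<Longrightarrow> path_length A (c @ [hd c]) = 0"
begin

lemma A_self [simp]: "A x x = 0"
  using A_nonadj by simp

lemma geo_endsE: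
  assumes "geo w z g"
  obtains "g = butlast g @ [z]" "g = w # tl g" "successively (adj p) g"
  using assms by (cases g) (auto simp: geo_def paths_def)

lemma geo_interiorE:
  assumes "geo w z g" "w \<noteq> z"
  obtains b where "g = w # b @ [z]" "successively (adj p) (w # b @ [z])"
proof (cases g)
  case (Cons u r)
  then show ?thesis using assms that by (cases r rule: rev_cases) (auto simp: geo_def paths_def)
qed (use assms in \<open>auto simp: geo_def paths_def\<close>)

text \<open>The geodesic closes \<open>x, y, w\<close> to a cycle. If it is not a triangle, let
  \<open>u\<close> follow \<open>w\<close> on the geodesic: \<open>x, y, w, u\<close> inherits the
  strict inequality, and the rest from \<open>u\<close> to \<open>x\<close> is again a
  geodesic.\<close>

lemma form_sum_triangle_walk:
  assumes "adj p x y" "adj p y w" "geo w x g" "w \<noteq> x" "y \<notin> set g"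
    and short: "g = [w, x] \<or> d x w < d x y + d y w"
  shows "A x y + A y w + path_length A g = 0"
proof -
  obtain b where b: "g = w # b @ [x]"
    and succ: "successively (adj p) (w # b @ [x])"
    using geo_interiorE[OF assms(3,4)] .
  define c where "c = [x, y] @ w # b"
  have cyc: "is_cycle p c"
    using geo_distinct[OF assms(3)] succ assms(1,2,4,5) unfolding b c_def
    by (intro is_cycleI) (auto simp: adj_def)
  have "c \<in> X2 p d"
  proof (cases b)
    case Nil
    then show ?thesis using cyc same_cycle_refl[of c] by (auto simp: X2_def c_def)
  next
    case (Cons u b')
    then have g: "geo w x ([w] @ u # b' @ [x])" using assms(3) b by simp
    have "d x u < d x y + d y w + d w u"
      using geo_split(3)[OF g] short b Cons d_nonneg[of w u] by (auto simp: d_sym)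
    moreover have "geodesic p d (u # b' @ [x])" using geo_split(2)[OF g] by (rule geodesic_if_geo)
    ultimately have "same_cycle c c \<and> length c > 3 \<and>
        d (c ! 0) (c ! 3) < d (c ! 0) (c ! 1) + d (c ! 1) (c ! 2) + d (c ! 2) (c ! 3) \<and>
        geodesic p d (drop 3 c @ [c ! 0])"
      using Cons by (simp add: c_def same_cycle_refl eval_nat_numeral)
    then show ?thesis using cyc by (auto simp: X2_def)
  qed
  then show ?thesis using A_cycle[of c] by (simp add: b c_def)
qed

lemma form_sum_quad_walk:
  assumes "adj p z x" "adj p x y" "adj p y w" "geo w z g" "w \<noteq> z" "z \<noteq> y" "x \<notin> set g" "y \<notin> set g"
    and short: "d z w < d z x + d x y + d y w"
  shows "A z x + A x y + A y w + path_length A g = 0"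
proof -
  obtain b where b: "g = w # b @ [z]"
    and succ: "successively (adj p) (w # b @ [z])"
    using geo_interiorE[OF assms(4,5)] .
  define c where "c = [z, x, y] @ w # b"
  have cyc: "is_cycle p c"
    using geo_distinct[OF assms(4)] succ assms(1,2,3,5-8) unfolding b c_def
    by (intro is_cycleI) (auto simp: adj_def)
  have "same_cycle c c \<and> length c > 3 \<and>
      d (c ! 0) (c ! 3) < d (c ! 0) (c ! 1) + d (c ! 1) (c ! 2) + d (c ! 2) (c ! 3) \<and>
      geodesic p d (drop 3 c @ [c ! 0])"
    using short geodesic_if_geo[OF assms(4)]
    by (simp add: c_def b same_cycle_refl eval_nat_numeral)
  then have "c \<in> X2 p d" using cyc by (auto simp: X2_def)
  then show ?thesis using A_cycle[of c] by (simp add: b c_def)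
qed

lemma geo_form_sum_concat:
  assumes "geo x v g" "path_length A g = s" "geo v y h" "path_length A h = t" "d x v + d v y \<le> d x y"
  shows "\<exists>k. geo x y k \<and> path_length A k = s + t"
proof -
  obtain xs ys where "g = xs @ [v]" "h = v # ys" using assms(1,3) by (metis geo_endsE)
  then show ?thesis
    using assms geo_concat[of x v xs y ys] path_length_append[of A xs v ys] by auto
qed

text \<open>The two steps backtrack, or are themselves geodesic, or every geodesic from
  \<open>w\<close> to \<open>x\<close> misses \<open>y\<close> and closes them to a cycle in
  \<open>X2\<close>, on which the form sums to zero.\<close>

lemma geodesic_replaces_two_steps:
  assumes "adj p w y" "adj p y x"
  shows "\<exists>g. geo w x g \<and> path_length A g = A w y + A y x"
proof -
  consider "w = x" | "d w y + d y x \<le> d w x" | "w \<noteq> x" "d w x < d w y + d y x" by linarith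
  then show ?thesis
  proof cases
    case 1
    then show ?thesis using geo_refl[of x] A_anti[of x y] by (intro exI[of _ "[x]"]) auto
  next
    case 2
    then show ?thesis
      using geo_form_sum_concat[OF geo_edge _ geo_edge, of w y "A w y" x "A y x"] assms by auto
  next
    case 3
    obtain g where g: "geo w x g" using geo_exists by blast
    have "y \<notin> set g" using geo_through[OF g, of y] 3 by auto
    then have "A x y + A y w + path_length A g = 0"
      using 3 g assms by (intro form_sum_triangle_walk) (auto intro: adj_sym simp: d_sym)
    then show ?thesis using g A_anti[of x y] A_anti[of y w] by (intro exI[of _ g]) auto
  qed
qed

lemma geodesic_replaces_three_steps:
  assumes "adj p w y" "adj p y x" "adj p x z"
  shows "\<exists>g. geo w z g \<and> path_length A g = A w y + A y x + A x z"
proof -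
  \<comment> \<open>Cases 1 and 2 backtrack and case 3 is a triangle. In cases 4 and 5 some geodesic
    passes through \<open>x\<close> or \<open>y\<close>, which reduces to two steps. In case 6
    geodesics miss both, and \<open>z, x, y, w\<close> starts a cycle in \<open>X2\<close>.\<close>
  consider "z = y" | "w = x" | "w = z" "z \<noteq> y" "w \<noteq> x" | "d w x + d x z \<le> d w z" | "d w y + d y z \<le> d w z"
    | "w \<noteq> z" "z \<noteq> y" "d w x + d x z > d w z" "d w y + d y z > d w z" by linarith
  then show ?thesis
  proof cases
    case 1
    then show ?thesis using geo_edge[OF assms(1)] A_anti[of x y] by (intro exI[of _ "[w, y]"]) auto
  next
    case 2
    then show ?thesis using geo_edge[OF assms(3)] A_anti[of x y] by (intro exI[of _ "[x, z]"]) auto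
  next
    case 3
    have "A x y + A y w + path_length A [w, x] = 0"
      using 3 assms geo_edge[of w x] adj_sym[of w y] adj_sym[of y x] adj_sym[of x z]
      by (intro form_sum_triangle_walk) auto
    then show ?thesis
      using 3 geo_refl[of w] A_anti[of x y] A_anti[of y w] A_anti[of x w]
      by (intro exI[of _ "[w]"]) auto
  next
    case 4
    obtain g where "geo w x g" "path_length A g = A w y + A y x"
      using geodesic_replaces_two_steps assms by blast
    from geo_form_sum_concat[OF this geo_edge[OF assms(3)], of "A x z"] 4 show ?thesis by auto
  next
    case 5
    obtain g where "geo y z g" "path_length A g = A y x + A x z"
      using geodesic_replaces_two_steps assms by blast
    from geo_form_sum_concat[OF geo_edge[OF assms(1)] _ this, of "A w y"] 5 show ?thesis
      by (auto simp: add.assoc)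
  next
    case 6
    obtain g where g: "geo w z g" using geo_exists by blast
    have "x \<notin> set g" "y \<notin> set g" using geo_through[OF g, of x] geo_through[OF g, of y] 6 by auto
    moreover have "d z w < d z x + d x y + d y w"
      using 6 d_triangle[of w x y] d_sym[of z w] d_sym[of z x] d_sym[of y w] d_sym[of x y] by linarith
    ultimately have "A z x + A x y + A y w + path_length A g = 0"
      using 6 g assms by (intro form_sum_quad_walk) (auto intro: adj_sym)
    then show ?thesis
      using g A_anti[of x y] A_anti[of y w] A_anti[of x z] by (intro exI[of _ g]) auto
  qed
qed

text \<open>
  Up to a constant, the form has on the two neighbourhoods of an edge a common primitive, given by
  \<open>A z x\<close> on the neighbourhood of \<open>x\<close> and by \<open>A w y + A y x\<close> on that of \<open>y\<close>.
\<close>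

lemma geodesic_between_nbhds:
  assumes "adj p x y" "z \<in> nbhd x" "w \<in> nbhd y"
  shows "\<exists>g. geo w z g \<and> path_length A g = A w y + A y x - A z x"
proof -
  note yx = adj_sym[OF assms(1)]
  consider "z = x" "w = y" | "z = x" "adj p w y" | "adj p x z" "w = y" | "adj p x z" "adj p w y"
    using assms(2,3) adj_sym by (auto simp: nbhd_def)
  then show ?thesis
  proof cases
    case 1
    then show ?thesis using geo_edge[OF yx] by (intro exI[of _ "[y, x]"]) auto
  next
    case 2
    then show ?thesis using geodesic_replaces_two_steps[of w y x] yx by auto
  next
    case 3
    then show ?thesis using geodesic_replaces_two_steps[of y x z] yx A_anti[of x z] by auto
  next
    case 4
    then show ?thesis using geodesic_replaces_three_steps[of w y x z] yx A_anti[of x z] by auto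
  qed
qed

end

section \<open>Tight paths and the Lipschitz bound\<close>

locale unit_form = closed_form p d A for p d A :: "'a::finite \<Rightarrow> 'a \<Rightarrow> real" +
  assumes A_le: "adj p x y \<Longrightarrow> A x y \<le> d x y"
begin

text \<open>Where \<open>A y x = f y - f x\<close>, the primitive \<open>f\<close> rises with slope
  one along tight paths. The length is recorded because it may exceed \<open>d x y\<close>: a tight
  path may wind around a cycle that carries no primitive.\<close>

inductive tight :: "'a \<Rightarrow> 'a \<Rightarrow> real \<Rightarrow> bool" where
  tight_refl: "tight x x 0"
| tight_step: "adj p x y \<Longrightarrow> A y x = d x y \<Longrightarrow> tight y z l \<Longrightarrow> tight x z (d x y + l)"

lemma tight_trans: "tight x y l \<Longrightarrow> tight y z m \<Longrightarrow> tight x z (l + m)"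
proof (induction rule: tight.induct)
  case (tight_step x y' y l)
  then have "tight x z (d x y' + (l + m))" by (intro tight.tight_step) auto
  then show ?case by (simp add: add.assoc)
qed simp

lemma tight_nonneg: "tight x y l \<Longrightarrow> 0 \<le> l"
  by (induction rule: tight.induct) (auto intro: add_nonneg_nonneg d_nonneg)

lemma form_sum_le: "successively (adj p) g \<Longrightarrow> path_length A g \<le> path_length d g"
proof (induction g rule: induct_list012)
  case (3 x y zs)
  then show ?case using A_le[of x y] by auto
qed (auto simp: path_length_def)

text \<open>The form is bounded by the length on every edge, so equality of the sums forces equality
  on each. Orientation flips: \<open>A u v = d u v\<close> makes the edge from \<open>v\<close> to
  \<open>u\<close> tight.\<close>

lemma tight_if_form_sum_ge:
  assumes "g \<in> paths p w z" "path_length d g \<le> path_length A g"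
  shows "tight z w (path_length d g)"
  using assms
proof (induction g arbitrary: w rule: induct_list012)
  case 1
  then show ?case by (simp add: paths_def)
next
  case (2 x)
  then show ?case by (auto simp: paths_def intro: tight_refl)
next
  case (3 x y zs)
  then have xy: "adj p x y" "x = w" and yzs: "y # zs \<in> paths p y z" by (auto simp: paths_def)
  have "path_length A (y # zs) \<le> path_length d (y # zs)" "A x y \<le> d x y"
    using yzs xy A_le by (auto simp: paths_def intro: form_sum_le)
  then have eq: "path_length d (y # zs) \<le> path_length A (y # zs)" "A x y = d x y"
    using 3(4) by auto
  have "tight z y (path_length d (y # zs))" using 3(2)[OF yzs eq(1)] .
  moreover have "tight y x (d y x + 0)"
    using eq(2) xy(1) by (intro tight_step tight_refl) (auto simp: d_sym adj_sym)
  ultimately have "tight z x (path_length d (y # zs) + (d y x + 0))" by (rule tight_trans)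
  then show ?case using xy(2) by (simp add: d_sym add.commute)
qed

text \<open>The difference of the primitive is the sum of the form along a geodesic, hence at most
  its length; in case of equality this geodesic, reversed, is tight.\<close>

lemma primitive_Lipschitz:
  assumes "adj p x y" "z \<in> nbhd x" "w \<in> nbhd y"
  shows "A w y + A y x - A z x \<le> d z w"
    and "A w y + A y x - A z x = d z w \<Longrightarrow> tight z w (d z w)"
proof -
  obtain g where g: "geo w z g" "path_length A g = A w y + A y x - A z x"
    using geodesic_between_nbhds[OF assms] by blast
  have "path_length A g \<le> path_length d g" using g(1) by (intro form_sum_le) (auto simp: geo_def paths_def)
  moreover have len: "path_length d g = d z w" using g(1) d_sym[of z w] by (simp add: geo_def)
  ultimately show "A w y + A y x - A z x \<le> d z w" using g(2) by simp
  show "tight z w (d z w)" if "A w y + A y x - A z x = d z w"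
    using tight_if_form_sum_ge[of g w z] g len that by (simp add: geo_def)
qed

end

subsection \<open>Transport under non-negative curvature\<close>

locale nonneg_curved = path_metric p d for p d :: "'a::finite \<Rightarrow> 'a \<Rightarrow> real" +
  assumes curv: "nonneg_ollivier_curvature p d"
begin

lemma laplacian_le_if_unit_slope:
  assumes "adj p x y" and Lip: "\<And>u v. g u - g v \<le> d u v" and slope: "g y - g x = d x y"
  shows "laplacian p g y \<le> laplacian p g x"
proof -
  let ?P = "{(x, y). x \<noteq> y} :: ('a \<times> 'a) set"
  let ?S = "{f. grad d y x f = 1 \<and> grad_norm d f = 1}"
  have dxy: "d x y > 0" using assms(1) by (intro d_pos) (auto simp: adj_def)
  have yx: "grad d y x g = 1" using slope dxy by (simp add: grad_def d_sym[of y x])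
  have "\<bar>grad d u v g\<bar> \<le> 1" if "u \<noteq> v" for u v
    using Lip[of u v] Lip[of v u] d_pos[OF that] d_sym[of u v] by (simp add: grad_def abs_le_iff)
  moreover have "1 \<in> (\<lambda>(x, y). \<bar>grad d x y g\<bar>) ` ?P"
    using yx assms(1) by (force simp: adj_def)
  ultimately have "grad_norm d g = 1"
    unfolding grad_norm_def by (intro cSup_eq_maximum) auto
  then have gS: "g \<in> ?S" using yx by simp
  \<comment> \<open>The real infimum is a lower bound only for sets bounded below. Admissible
    functions are 1-Lipschitz, which bounds their Laplacians by the diameter.\<close>
  have lap: "\<bar>laplacian p f u\<bar> \<le> diam" if "f \<in> ?S" for f u
  proof -
    have "\<bar>f v - f u\<bar> \<le> diam" for v
    proof (cases "v = u")
      case False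
      have "\<bar>grad d v u f\<bar> \<le> grad_norm d f"
        unfolding grad_norm_def using False
        by (intro cSUP_upper2[of _ _ "(v, u)"]) (auto intro!: bdd_above_finite)
      then have "\<bar>f v - f u\<bar> \<le> d v u"
        using that d_pos[OF False] by (simp add: grad_def abs_divide divide_le_eq)
      also have "d v u \<le> diam" by (rule d_le_diam)
      finally show ?thesis .
    next
      case True
      then show ?thesis using d_le_diam[of u u] by simp
    qed
    then have "\<bar>laplacian p f u\<bar> \<le> (\<Sum>v\<in>UNIV. p u v * diam)"
      unfolding laplacian_def
      by (intro order_trans[OF sum_abs] sum_mono) (auto simp: abs_mult p_nonneg mult_left_mono)
    then show ?thesis by (simp add: p_sum flip: sum_distrib_right)
  qed
  have "bdd_below ((\<lambda>f. grad d x y (laplacian p f)) ` ?S)"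
  proof (rule bdd_belowI2[of _ "- (2 * diam) / d x y"])
    fix f assume "f \<in> ?S"
    then have "- (2 * diam) \<le> laplacian p f x - laplacian p f y"
      using lap[of f x] lap[of f y] by linarith
    then show "- (2 * diam) / d x y \<le> grad d x y (laplacian p f)"
      unfolding grad_def using dxy by (intro divide_right_mono) auto
  qed
  then have "ollivier_curvature p d x y \<le> grad d x y (laplacian p g)"
    unfolding ollivier_curvature_def using gS by (rule cINF_lower)
  then have "0 \<le> grad d x y (laplacian p g)"
    using curv assms(1) unfolding nonneg_ollivier_curvature_def by fastforce
  then show ?thesis using dxy by (simp add: grad_def zero_le_divide_iff)
qed

text \<open>
  Kantorovich form of the curvature bound for the lazy walk. The McShane extension \<open>g\<close> of \<open>\<phi>\<close>
  lies below \<open>\<phi>\<close> near \<open>x\<close> and above \<open>\<psi>\<close> near \<open>y\<close>. The curvature bound applies only to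
  functions of slope one along the edge, so \<open>g\<close> is raised near \<open>y\<close> to \<open>g'\<close>; laziness absorbs
  the error.
\<close>

lemma mean_diff_le:
  assumes xy: "adj p x y" and le: "\<And>z w. z \<in> nbhd x \<Longrightarrow> w \<in> nbhd y \<Longrightarrow> \<psi> w - \<phi> z \<le> d z w"
  shows "mean y \<psi> - mean x \<phi> \<le> d x y"
proof -
  define g where "g v = Min ((\<lambda>z. \<phi> z + d z v) ` nbhd x)" for v
  have g_le: "g v \<le> \<phi> z + d z v" if "z \<in> nbhd x" for z v
    unfolding g_def using that by (intro Min_le) auto
  have g_attained: "\<exists>z\<in>nbhd x. g v = \<phi> z + d z v" for v
  proof -
    have "g v \<in> (\<lambda>z. \<phi> z + d z v) ` nbhd x"
      unfolding g_def by (intro Min_in) (auto simp: nbhd_def)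
    then show ?thesis by auto
  qed
  have g_Lip: "g u - g v \<le> d u v" for u v
  proof -
    obtain z where "z \<in> nbhd x" "g v = \<phi> z + d z v" using g_attained by blast
    then show ?thesis using g_le[of z u] d_triangle[of z u v] d_sym[of u v] by auto
  qed
  have g_x: "g z \<le> \<phi> z" if "z \<in> nbhd x" for z using g_le[OF that, of z] by simp
  have g_y: "\<psi> w \<le> g w" if w: "w \<in> nbhd y" for w
  proof -
    obtain z where "z \<in> nbhd x" "g w = \<phi> z + d z w" using g_attained by blast
    then show ?thesis using le[of z w] w by auto
  qed
  define g' where "g' v = max (g v) (g x + d x y - d y v)" for v
  have g'x: "g' x = g x" and g'y: "g' y = g x + d x y"
    using g_Lip[of y x] by (auto simp: g'_def d_sym[of y x])
  have "g' u - g' v \<le> d u v" for u v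
    using g_Lip[of u v] d_triangle[of y v u] d_sym[of u v] unfolding g'_def by linarith
  then have "laplacian p g' y \<le> laplacian p g' x"
    by (rule laplacian_le_if_unit_slope[OF xy]) (simp add: g'x g'y)
  then have 1: "(\<Sum>v\<in>UNIV. p y v * g' v) - (\<Sum>v\<in>UNIV. p x v * g' v) \<le> d x y"
    by (simp add: laplacian_def right_diff_distrib sum_subtractf p_sum g'x g'y flip: sum_distrib_right)
  have 2: "(\<Sum>v\<in>UNIV. p y v * g v) \<le> (\<Sum>v\<in>UNIV. p y v * g' v)"
    by (intro sum_mono mult_left_mono p_nonneg) (simp add: g'_def)
  \<comment> \<open>Raising costs at most the deficit \<open>g x + d x y - g y\<close>. The holding
    term \<open>g y - g x\<close> equals \<open>d x y\<close> minus this deficit, so the two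
    cancel.\<close>
  have "(\<Sum>v\<in>UNIV. p x v * g' v) \<le> (\<Sum>v\<in>UNIV. p x v * (g v + (g x + d x y - g y)))"
  proof (intro sum_mono mult_left_mono p_nonneg)
    fix v show "g' v \<le> g v + (g x + d x y - g y)"
      using g_Lip[of y v] g_Lip[of y x] d_sym[of y x] unfolding g'_def by linarith
  qed
  also have "\<dots> = (\<Sum>v\<in>UNIV. p x v * g v) + (g x + d x y - g y)"
    by (simp add: distrib_left sum.distrib p_sum flip: sum_distrib_right)
  finally have "((\<Sum>v\<in>UNIV. p y v * g v) + g y) - ((\<Sum>v\<in>UNIV. p x v * g v) + g x) \<le> 2 * d x y"
    using 1 2 by linarith
  then have "mean y g - mean x g \<le> d x y" by (simp add: mean_def field_simps)
  moreover have "mean y \<psi> \<le> mean y g" "mean x g \<le> mean x \<phi>"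
    using g_x g_y by (auto intro: mean_mono)
  ultimately show ?thesis by linarith
qed

end

subsection \<open>Tight paths of harmonic forms\<close>

locale harmonic_unit_form = unit_form p d A + nonneg_curved p d
  for p d A :: "'a::finite \<Rightarrow> 'a \<Rightarrow> real" +
  fixes C :: real
  assumes divergence: "(\<Sum>y\<in>UNIV. p x y * A x y) = C"
begin

lemma mean_form: "mean x (\<lambda>v. A v x) = - C / 2"
proof -
  have "(\<Sum>v\<in>UNIV. p x v * A v x) = (\<Sum>v\<in>UNIV. - (p x v * A x v))"
    by (intro sum.cong refl) (simp add: A_anti[of _ x])
  then show ?thesis by (simp add: mean_def sum_negf divergence)
qed

text \<open>
  A dual substitute for a coupling of the lazy steps from \<open>x\<close> and \<open>y\<close> that moves mass along tight
  paths only: by harmonicity the primitive attains equality in the Kantorovich bound, and pairs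
  that are not tight leave room for a small perturbation.
\<close>

lemma tight_edge_mean_le:
  assumes xy: "adj p x y" "A y x = d x y"
    and le: "\<And>z w. z \<in> nbhd x \<Longrightarrow> w \<in> nbhd y \<Longrightarrow> A w y + d x y - A z x = d z w \<Longrightarrow> b w \<le> a z"
  shows "mean y b \<le> mean x a"
proof -
  define s where "s z w = d z w - (A w y + d x y - A z x)" for z w
  define P where "P = {(z, w). z \<in> nbhd x \<and> w \<in> nbhd y \<and> s z w > 0}"
  \<comment> \<open>So small that on pairs with positive slack the perturbation stays within the
    slack. The \<open>+ 1\<close> avoids division by zero, the inserted \<open>1\<close> covers
    empty \<open>P\<close>.\<close>
  define e where "e = Min (insert 1 ((\<lambda>(z, w). s z w / (\<bar>b w - a z\<bar> + 1)) ` P))"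
  have e: "e > 0"
    unfolding e_def by (subst Min_gr_iff) (auto simp: P_def intro!: divide_pos_pos)
  have "(A w y + d x y + e * b w) - (A z x + e * a z) \<le> d z w"
    if zw: "z \<in> nbhd x" "w \<in> nbhd y" for z w
  proof -
    have s: "s z w \<ge> 0" using primitive_Lipschitz(1)[OF xy(1) zw] xy(2) by (simp add: s_def)
    have "e * (b w - a z) \<le> s z w"
    proof (cases "s z w = 0")
      case True
      then show ?thesis using le[OF zw] e by (auto simp: s_def mult_nonneg_nonpos)
    next
      case False
      then have "e \<le> s z w / (\<bar>b w - a z\<bar> + 1)"
        using s zw unfolding e_def P_def by (intro Min_le) auto
      then have "e * (\<bar>b w - a z\<bar> + 1) \<le> s z w" by (simp add: pos_le_divide_eq)
      moreover have "e * (b w - a z) \<le> e * (\<bar>b w - a z\<bar> + 1)" using e by (intro mult_left_mono) auto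
      ultimately show ?thesis by linarith
    qed
    then show ?thesis by (simp add: s_def algebra_simps)
  qed
  \<comment> \<open>Both means of the form equal \<open>- C / 2\<close> and cancel, as does
    \<open>d x y\<close>; only the perturbation is left.\<close>
  from mean_diff_le[OF xy(1) this]
  have "mean y (\<lambda>w. A w y + d x y + e * b w) - mean x (\<lambda>z. A z x + e * a z) \<le> d x y" by simp
  then have "e * mean y b \<le> e * mean x a"
    by (simp add: mean_add mean_scale mean_const mean_form)
  then show ?thesis using e by simp
qed

text \<open>Induction along the path composes the one-edge bounds. A primitive rises along a tight
  path by exactly its length, so moving the ends to \<open>z\<close> and \<open>w\<close> changes
  the length by \<open>A w y - A z x\<close>.\<close>

lemma tight_mean_le:
  assumes "tight x y l"
    and "\<And>z w m. z \<in> nbhd x \<Longrightarrow> w \<in> nbhd y \<Longrightarrow> tight z w m \<Longrightarrow> m = l + A w y - A z x \<Longrightarrow> b w \<le> a z"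
  shows "mean y b \<le> mean x a"
  using assms
proof (induction arbitrary: a rule: tight.induct)
  case (tight_refl x)
  then show ?case using tight.tight_refl by (intro mean_mono) auto
next
  case (tight_step x y z l)
  define Q where "Q u = a ` {v \<in> nbhd x. A u y + d x y - A v x = d v u}" for u
  \<comment> \<open>An intermediate function, dual to gluing couplings: the minimum of
    \<open>a\<close> over the partners of \<open>u\<close>. The inserted maximum serves vertices
    without partners and never falls below \<open>b\<close>.\<close>
  define a' where "a' u = Min (insert (Max (range b)) (Q u))" for u
  have "mean y a' \<le> mean x a"
  proof (rule tight_edge_mean_le[OF tight_step.hyps(1,2)])
    fix v u assume "v \<in> nbhd x" "u \<in> nbhd y" "A u y + d x y - A v x = d v u"
    then show "a' u \<le> a v" unfolding a'_def Q_def by (intro Min_le) auto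
  qed
  moreover have "mean z b \<le> mean y a'"
  proof (rule tight_step.IH)
    fix u w m assume u: "u \<in> nbhd y" and w: "w \<in> nbhd z" and uw: "tight u w m"
      and m: "m = l + A w z - A u y"
    have "b w \<le> a v" if v: "v \<in> nbhd x" "A u y + d x y - A v x = d v u" for v
    proof (rule tight_step.prems[OF v(1) w])
      have "tight v u (d v u)"
        using primitive_Lipschitz(2)[OF tight_step.hyps(1) v(1) u] v(2) tight_step.hyps(2) by simp
      then show "tight v w (d v u + m)" using uw by (rule tight_trans)
      show "d v u + m = d x y + l + A w z - A v x" using m v(2) by simp
    qed
    moreover have "b w \<le> Max (range b)" by (intro Max_ge) auto
    ultimately show "b w \<le> a' u" unfolding a'_def Q_def by (subst Min_ge_iff) auto
  qed
  ultimately show ?case by linarith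
qed

definition tails :: "'a set" where
  "tails = {x. \<exists>y. adj p x y \<and> A y x = d x y}"

lemma tight_from_non_tail: "tight x y l \<Longrightarrow> x \<notin> tails \<Longrightarrow> l = 0"
  by (induction rule: tight.induct) (auto simp: tails_def)

text \<open>
  The probability that the walk from \<open>x\<close> stays in \<open>tails\<close> decays geometrically, whereas tight
  paths get longer by at most \<open>2 * D\<close> in each step.
\<close>

lemma tight_length_le:
  assumes D: "\<And>u v. d u v \<le> D" and \<rho>: "0 \<le> \<rho>" and h0: "\<And>x. 0 \<le> h x" and h1: "\<And>x. x \<in> tails \<Longrightarrow> 1 \<le> h x"
    and h\<rho>: "\<And>x. x \<in> tails \<Longrightarrow> mean x h \<le> \<rho> * h x"
    and "tight x y l" "l \<le> R"
  shows "l \<le> (R + 2 * real n * D) * \<rho> ^ n * h x"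
  using assms(6,7)
proof (induction n arbitrary: x y l R)
  case 0
  have R: "0 \<le> R" using 0 tight_nonneg by fastforce
  show ?case
  proof (cases "x \<in> tails")
    case True
    then have "R * 1 \<le> R * h x" using R h1 by (intro mult_left_mono) auto
    then show ?thesis using 0 by simp
  next
    case False
    then have "l = 0" using 0 tight_from_non_tail by blast
    then show ?thesis using h0[of x] R by simp
  qed
next
  case (Suc n)
  have R: "0 \<le> R" using Suc.prems tight_nonneg by fastforce
  have D0: "0 \<le> D" using D[of x x] by simp
  define K where "K = (R + 2 * real (Suc n) * D) * \<rho> ^ n"
  have K: "0 \<le> K" unfolding K_def using R D0 \<rho> by simp
  show ?case
  proof (cases "x \<in> tails")
    case True
    \<comment> \<open>The new length \<open>m\<close> is at most \<open>R + 2 * D\<close>, so the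
      induction hypothesis bounds it by \<open>K * h z\<close>. The means of the form at both ends
      agree, which leaves a bound on \<open>l\<close> itself.\<close>
    have "mean y (\<lambda>w. A w y + l) \<le> mean x (\<lambda>z. A z x + K * h z)"
    proof (rule tight_mean_le[OF Suc.prems(1)])
      fix z w m assume z: "z \<in> nbhd x" and w: "w \<in> nbhd y" and zw: "tight z w m"
        and m: "m = l + A w y - A z x"
      have "A w y \<le> D" "- A z x \<le> D"
        using z w A_le[of w y] A_le[of x z] A_anti[of x z] D[of w y] D[of x z] D0
        by (auto simp: nbhd_def adj_sym)
      then have "m \<le> R + 2 * D" using m Suc.prems(2) by linarith
      from Suc.IH[OF zw this] have "m \<le> K * h z" by (simp add: K_def algebra_simps)
      then show "A w y + l \<le> A z x + K * h z" using m by simp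
    qed
    then have "l \<le> K * mean x h" by (simp add: mean_add mean_scale mean_const mean_form)
    also have "\<dots> \<le> K * (\<rho> * h x)" using h\<rho>[OF True] K by (intro mult_left_mono) auto
    finally show ?thesis by (simp add: K_def algebra_simps)
  next
    case False
    then have "l = 0" using Suc.prems tight_from_non_tail by blast
    then show ?thesis using h0[of x] R D0 \<rho> by simp
  qed
qed

lemma tails_eq_UNIV:
  assumes "tails \<noteq> {}"
  shows "tails = UNIV"
proof (rule ccontr)
  assume "tails \<noteq> UNIV"
  then obtain h \<rho> where h: "0 \<le> \<rho>" "\<rho> < 1" "\<And>x. 0 \<le> h x" "\<And>x. x \<in> tails \<Longrightarrow> 1 \<le> h x"
    "\<And>x. x \<in> tails \<Longrightarrow> mean x h \<le> \<rho> * h x"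
    using strict_supersolution_exists by metis
  obtain x y where xy: "adj p x y" "A y x = d x y" using assms by (auto simp: tails_def)
  have "tight x y (d x y)" using tight_step[OF xy tight_refl] by simp
  then have le: "d x y \<le> (d x y + 2 * real n * diam) * \<rho> ^ n * h x" for n
    using tight_length_le[OF d_le_diam h(1,3,4,5)] by blast
  \<comment> \<open>The bound holds for every \<open>n\<close> and tends to zero: geometric decay
    beats linear growth.\<close>
  have "(\<lambda>n. d x y * h x * \<rho> ^ n + 2 * diam * h x * (real n * \<rho> ^ n)) \<longlonglongrightarrow>
      d x y * h x * 0 + 2 * diam * h x * 0"
    using h(1,2) powser_times_n_limit_0[of \<rho>] by (intro tendsto_intros) auto
  moreover have "d x y \<le> d x y * h x * \<rho> ^ n + 2 * diam * h x * (real n * \<rho> ^ n)" for n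
    using le[of n] by (simp add: algebra_simps)
  ultimately have "d x y \<le> 0" by (intro LIMSEQ_le_const) auto
  then show False using d_pos[of x y] xy(1) by (auto simp: adj_def)
qed

end

subsection \<open>Symmetric families of functionals\<close>

lemma extreme_point_uminus:
  fixes P :: "'v::real_vector set"
  assumes sym: "\<And>x. x \<in> P \<Longrightarrow> - x \<in> P" and x: "x extreme_point_of P"
  shows "(- x) extreme_point_of P"
  unfolding extreme_point_of_def
proof (intro conjI ballI notI)
  show "- x \<in> P" using sym x by (simp add: extreme_point_of_def)
  fix a b assume ab: "a \<in> P" "b \<in> P" "- x \<in> open_segment a b"
  have "open_segment (- a) (- b) = uminus ` open_segment a b"
    by (rule open_segment_linear_image) (auto simp: linear_iff)
  then have "x \<in> open_segment (- a) (- b)" using ab(3) by (metis image_eqI minus_minus)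
  then show False using x ab sym by (auto simp: extreme_point_of_def)
qed

text \<open>
  On \<open>E\<close> the functionals \<open>w y\<close> have the same support function as their negatives, so their
  convex hull in the dual space is centrally symmetric and of full dimension. A basis among its
  extreme points therefore yields twice as many extreme points.
\<close>

lemma dim_le_half_card_if_symmetric:
  fixes E :: "'v::euclidean_space set"
  assumes E: "subspace E" and S: "finite S"
    and sym: "\<And>\<alpha> m y. \<alpha> \<in> E \<Longrightarrow> (\<And>y. y \<in> S \<Longrightarrow> w y \<bullet> \<alpha> \<le> m) \<Longrightarrow> y \<in> S \<Longrightarrow> - m \<le> w y \<bullet> \<alpha>"
    and inj: "\<And>\<alpha>. \<alpha> \<in> E \<Longrightarrow> (\<And>y. y \<in> S \<Longrightarrow> w y \<bullet> \<alpha> = 0) \<Longrightarrow> \<alpha> = 0"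
  shows "2 * dim E \<le> card S"
proof -
  \<comment> \<open>Only restrictions to \<open>E\<close> matter; projection represents each
    functional by a vector of \<open>E\<close>.\<close>
  have decomp: "\<exists>b\<in>E. \<forall>\<alpha>\<in>E. a \<bullet> \<alpha> = b \<bullet> \<alpha>" for a
  proof -
    obtain b c where "b \<in> span E" "\<And>x. x \<in> span E \<Longrightarrow> orthogonal c x" "a = b + c"
      using orthogonal_subspace_decomp_exists[of E a] by blast
    moreover have "span E = E" using E by (simp add: span_eq_iff)
    ultimately show ?thesis by (intro bexI[of _ b]) (auto simp: inner_add_left orthogonal_def)
  qed
  then obtain v where v: "\<And>y. v y \<in> E" "\<And>y \<alpha>. \<alpha> \<in> E \<Longrightarrow> w y \<bullet> \<alpha> = v y \<bullet> \<alpha>"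
    using bchoice[of UNIV "\<lambda>y b. b \<in> E \<and> (\<forall>\<alpha>\<in>E. w y \<bullet> \<alpha> = b \<bullet> \<alpha>)"] by blast
  define P where "P = convex hull (v ` S)"
  have P: "compact P" "convex P" using S by (auto simp: P_def intro: finite_imp_compact_convex_hull)
  have neg: "- v y \<in> P" if y: "y \<in> S" for y
  proof (rule ccontr)
    assume "- v y \<notin> P"
    then obtain a b where ab: "a \<bullet> (- v y) < b" "\<And>x. x \<in> P \<Longrightarrow> a \<bullet> x > b"
      using separating_hyperplane_closed_point[of P "- v y"] P compact_imp_closed by blast
    obtain a' where a': "a' \<in> E" "\<And>\<alpha>. \<alpha> \<in> E \<Longrightarrow> a \<bullet> \<alpha> = a' \<bullet> \<alpha>" using decomp by blast
    \<comment> \<open>A hyperplane separating \<open>- v y\<close> from \<open>P\<close> contradicts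
      \<open>sym\<close> at \<open>- a'\<close>, where all functionals of the family are at most
      \<open>- b\<close>.\<close>
    have "- (- b) \<le> w y \<bullet> (- a')"
    proof (rule sym)
      show "- a' \<in> E" using a' E by (simp add: subspace_neg)
      fix u assume "u \<in> S"
      then have "a \<bullet> v u > b" using ab(2) by (auto simp: P_def intro: hull_inc)
      then show "w u \<bullet> (- a') \<le> - b" using a' v by (simp add: inner_commute)
    qed (rule y)
    then show False using ab(1) a' v by (simp add: inner_commute)
  qed
  have sP: "- x \<in> P" if "x \<in> P" for x
  proof -
    have "uminus ` P = convex hull (uminus ` v ` S)"
      unfolding P_def by (rule convex_hull_linear_image) (simp add: linear_iff)
    moreover have "convex hull (uminus ` v ` S) \<subseteq> P"
      using neg P by (intro hull_minimal) auto
    ultimately show ?thesis using that by blast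
  qed
  define X where "X = {x. x extreme_point_of P}"
  have X: "X \<subseteq> v ` S" unfolding X_def P_def by (rule extreme_points_of_convex_hull)
  have "P = convex hull X" unfolding X_def using P by (rule Krein_Milman_Minkowski)
  then have PX: "P \<subseteq> span X" using convex_hull_subset_span by blast
  obtain B where B: "B \<subseteq> X" "independent B" "X \<subseteq> span B"
    using maximal_independent_subset by blast
  have "finite X" using X S finite_surj by blast
  then have finB: "finite B" using B(1) finite_subset by blast
  have vB: "v y \<in> span B" if "y \<in> S" for y
  proof -
    have "v y \<in> P" using that by (auto simp: P_def intro: hull_inc)
    then show ?thesis using PX span_mono[OF B(3)] by (auto simp: span_span)
  qed
  have "B \<subseteq> E" using B(1) X v(1) by blast
  then have BE: "span B \<subseteq> E" using E by (rule span_minimal)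
  \<comment> \<open>A vector of \<open>E\<close> orthogonal to \<open>B\<close> is annihilated by
    every \<open>w y\<close>, hence zero by \<open>inj\<close>.\<close>
  have "span B = E"
  proof (rule ccontr)
    assume "span B \<noteq> E"
    then have "span B \<subset> span E" using BE E by (simp add: span_eq_iff[THEN iffD2] psubsetI)
    then obtain \<alpha> where \<alpha>: "\<alpha> \<noteq> 0" "\<alpha> \<in> span E" "\<And>y. y \<in> span B \<Longrightarrow> orthogonal \<alpha> y"
      using orthogonal_to_subspace_exists_gen by blast
    have \<alpha>E: "\<alpha> \<in> E" using \<alpha>(2) E by (simp add: span_eq_iff[THEN iffD2])
    have "w y \<bullet> \<alpha> = 0" if "y \<in> S" for y
      using \<alpha>(3)[OF vB[OF that]] v(2)[OF \<alpha>E] by (simp add: orthogonal_def inner_commute)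
    then show False using inj \<alpha>E \<alpha>(1) by blast
  qed
  then have dimE: "dim E = card B" using B(2) by (metis dim_eq_card_independent dim_span)
  have disj: "B \<inter> uminus ` B = {}"
  proof -
    have False if b: "b \<in> B" "- b \<in> B" for b
    proof -
      have "b \<noteq> 0" using B(2) b(1) dependent_zero by blast
      then have "- b \<noteq> b" by (metis add.right_inverse scaleR_2 scaleR_eq_0_iff zero_neq_numeral)
      then have "b \<in> span (B - {- b})" using b(1) by (intro span_base) auto
      then have "- b \<in> span (B - {- b})" by (rule span_neg)
      then show False using B(2) b(2) by (auto simp: dependent_def)
    qed
    then show ?thesis by auto
  qed
  have "uminus ` B \<subseteq> X" using B(1) extreme_point_uminus[OF sP] by (auto simp: X_def)
  then have "card (B \<union> uminus ` B) \<le> card X" using B(1) \<open>finite X\<close> by (intro card_mono) auto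
  also have "card (B \<union> uminus ` B) = 2 * card B"
    using finB disj by (simp add: card_Un_disjoint card_image)
  also have "card X \<le> card (v ` S)" using X S by (intro card_mono) auto
  also have "\<dots> \<le> card S" using S by (rule card_image_le)
  finally show ?thesis using dimE by simp
qed

subsection \<open>Harmonic forms\<close>

text \<open>Rank-nullity on a subspace: on the orthogonal complement \<open>C\<close> of the kernel
  within \<open>S\<close>, \<open>f\<close> is injective and has the same image.\<close>

lemma dim_image_plus_dim_kernel:
  fixes f :: "'v::euclidean_space \<Rightarrow> 'w::euclidean_space"
  assumes f: "linear f" and S: "subspace S"
  shows "dim (f ` S) + dim {x \<in> S. f x = 0} = dim S"
proof -
  define N where "N = {x \<in> S. f x = 0}"
  define C where "C = {y \<in> S. \<forall>x\<in>N. orthogonal x y}"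
  have N: "subspace N" and NS: "N \<subseteq> S"
    using S subspace_inter[OF S linear_subspace_kernel[OF f]] by (auto simp: N_def Int_def)
  have C: "subspace C" using S by (auto simp: C_def subspace_def orthogonal_clauses)
  have "dim C + dim N = dim S"
    unfolding C_def using N S NS by (rule dim_subspace_orthogonal_to_vectors)
  moreover have "inj_on f (span C)"
  proof -
    have "x = 0" if "x \<in> C" "f x = 0" for x
      using that by (auto simp: C_def N_def orthogonal_self)
    then have "inj_on f C" using linear_injective_on_subspace_0[OF f C] by blast
    then show ?thesis using C by (metis span_eq_iff)
  qed
  then have "dim (f ` C) = dim C" by (rule dim_image_eq[OF f])
  moreover have "f ` S = f ` C"
  proof (intro equalityI subsetI)
    fix z assume "z \<in> f ` S"
    then obtain u where u: "u \<in> S" "z = f u" by blast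
    obtain a b where ab: "a \<in> span N" "\<And>x. x \<in> span N \<Longrightarrow> orthogonal b x" "u = a + b"
      using orthogonal_subspace_decomp_exists[of N u] by blast
    have a: "a \<in> N" using ab(1) N by (metis span_eq_iff)
    then have "b \<in> C"
      using ab u NS subspace_diff[OF S u(1), of a] by (auto simp: C_def orthogonal_commute span_base)
    moreover have "f u = f b" using ab(3) a linear_add[OF f] by (simp add: N_def)
    ultimately show "z \<in> f ` C" using u by blast
  qed (auto simp: C_def)
  ultimately show ?thesis by (simp add: N_def)
qed

context path_metric
begin

text \<open>By connectedness only constants have zero differential.\<close>

lemma CARD_le_Suc_dim_range_delta0: "CARD('a) \<le> dim (range (delta0 p)) + 1"
proof -
  define f :: "real^'a \<Rightarrow> real^'a^'a" where "f g = delta0 p (\<lambda>x. g $ x)" for g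
  have lin: "linear f"
    by (rule linearI) (auto simp: f_def delta0_def vec_eq_iff algebra_simps)
  have "range f = range (delta0 p)"
  proof -
    have "delta0 p g = f (\<chi> x. g x)" for g by (simp add: f_def)
    then have "range (delta0 p) \<subseteq> range f" by (metis image_subsetI rangeI)
    then show ?thesis by (auto simp: f_def)
  qed
  moreover have "{g. f g = 0} \<subseteq> span {1}"
  proof
    fix g assume "g \<in> {g. f g = 0}"
    then have "f g $ x $ y = 0" for x y by simp
    from this[of x y for x y] have eq: "g $ x = g $ y" if "adj p x y" for x y
      using that by (simp add: f_def delta0_def) (metis eq_iff_diff_eq_0)
    obtain x0 :: 'a where True by simp
    have "y \<in> {y. g $ y = g $ x0}" for y
      by (rule adj_closed_UNIV[of x0]) (auto dest: eq)
    then have "g = (g $ x0) *\<^sub>R 1" by (auto simp: vec_eq_iff)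
    then show "g \<in> span {1}" by (metis span_base span_scale singletonI)
  qed
  then have "dim {g. f g = 0} \<le> 1" using dim_le_card[of "{g. f g = 0}" "{1}"] by simp
  ultimately show ?thesis using dim_image_plus_dim_kernel[OF lin subspace_UNIV] by simp
qed

definition divergence_at :: "real^'a^'a \<Rightarrow> 'a \<Rightarrow> real" where
  "divergence_at \<alpha> x = (\<Sum>y\<in>UNIV. p x y * \<alpha> $ x $ y)"

text \<open>Divergence zero would be too much to ask: adding an exact form does not change the mean
  of the divergence under the stationary distribution.\<close>

definition harmonic_forms :: "(real^'a^'a) set" where
  "harmonic_forms = {\<alpha> \<in> ker_delta1 p d. \<forall>x y. divergence_at \<alpha> x = divergence_at \<alpha> y}"

text \<open>Constant divergence imposes at most \<open>CARD('a) - 1\<close> linear conditions, no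
  more than the dimension of the exact forms divided out.\<close>

lemma subspace_harmonic_forms: "subspace harmonic_forms"
  and betti1_le_dim_harmonic: "betti1 p d \<le> dim harmonic_forms"
proof -
  obtain x0 :: 'a where True by simp
  define f :: "real^'a^'a \<Rightarrow> real^'a" where "f \<alpha> = (\<chi> x. divergence_at \<alpha> x - divergence_at \<alpha> x0)" for \<alpha>
  have lin: "linear f"
    by (rule linearI)
      (auto simp: f_def divergence_at_def vec_eq_iff distrib_left sum.distrib sum_distrib_left algebra_simps)
  have H: "harmonic_forms = {\<alpha> \<in> ker_delta1 p d. f \<alpha> = 0}"
    by (auto simp: harmonic_forms_def f_def vec_eq_iff) metis
  show "subspace harmonic_forms"
    using subspace_inter[OF subspace_ker_delta1[of p d] linear_subspace_kernel[OF lin]]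
    by (simp add: H Int_def)
  have "f ` ker_delta1 p d \<subseteq> {v. axis x0 1 \<bullet> v = 0}" by (auto simp: inner_axis' f_def)
  then have "dim (f ` ker_delta1 p d) \<le> dim {v :: real^'a. axis x0 1 \<bullet> v = 0}" by (rule dim_subset)
  also have "\<dots> = CARD('a) - 1" by (subst dim_hyperplane) (auto simp: axis_eq_0_iff)
  finally show "betti1 p d \<le> dim harmonic_forms"
    using dim_image_plus_dim_kernel[OF lin subspace_ker_delta1[of p d]]
      CARD_le_Suc_dim_range_delta0 betti1_eq_dim_diff[OF symm, of d] by (simp add: H)
qed

end

context nonneg_curved
begin

text \<open>The maximal slope \<open>L\<close> over all edges is also attained at \<open>x0\<close>,
  by \<open>tails_eq_UNIV\<close> for the form scaled by \<open>1 / L\<close>; so \<open>m\<close>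
  bounds it.\<close>

lemma harmonic_form_max_slope:
  assumes \<alpha>: "\<alpha> \<in> harmonic_forms" and m: "\<And>y. adj p y x0 \<Longrightarrow> \<alpha> $ y $ x0 \<le> m * d y x0"
    and uv: "adj p u v"
  shows "\<alpha> $ u $ v \<le> m * d u v"
proof -
  have ker: "\<alpha> \<in> ker_delta1 p d" using \<alpha> by (simp add: harmonic_forms_def)
  then have form: "\<alpha> \<in> one_forms p" by (simp add: ker_delta1_def)
  then have anti: "\<alpha> $ x $ y = - \<alpha> $ y $ x" and nonadj: "\<not> adj p x y \<Longrightarrow> \<alpha> $ x $ y = 0" for x y
    unfolding one_forms_def by blast+
  define Q where "Q = {(x, y). adj p x y}"
  define sl where "sl = (\<lambda>(x, y). \<alpha> $ x $ y / d x y)"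
  define L where "L = Max (sl ` Q)"
  have "sl ` Q \<noteq> {}" using uv by (auto simp: Q_def)
  then have "L \<in> sl ` Q" unfolding L_def by (intro Max_in) auto
  then obtain a b where ab: "adj p a b" "L = \<alpha> $ a $ b / d a b" by (auto simp: Q_def sl_def)
  have dpos: "d x y > 0" if "adj p x y" for x y using that d_pos by (auto simp: adj_def)
  have le: "\<alpha> $ x $ y \<le> L * d x y" if "adj p x y" for x y
  proof -
    have "sl (x, y) \<le> L" unfolding L_def using that by (intro Max_ge imageI) (auto simp: Q_def)
    then show ?thesis using dpos[OF that] by (simp add: sl_def pos_divide_le_eq)
  qed
  have "L \<le> m"
  proof (cases "L > 0")
    case True
    define A where "A x y = \<alpha> $ x $ y / L" for x y
    have scale: "path_length A xs = path_length (\<lambda>x y. \<alpha> $ x $ y) xs / L" for xs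
      by (simp add: path_length_def A_def sum_divide_distrib)
    interpret harmonic_unit_form p d A "divergence_at \<alpha> a / L"
    proof unfold_locales
      show "A x y = - A y x" for x y using anti[of x y] by (simp add: A_def)
      show "A x y = 0" if "\<not> adj p x y" for x y using nonadj[OF that] by (simp add: A_def)
      show "path_length A (c @ [hd c]) = 0" if "c \<in> X2 p d" for c
      proof -
        have "c \<noteq> []" using that by (auto simp: X2_def is_cycle_def)
        moreover have "delta1 \<alpha> c = 0" using ker that by (simp add: ker_delta1_def)
        ultimately show ?thesis by (simp add: scale delta1_eq_path_length)
      qed
      show "A x y \<le> d x y" if "adj p x y" for x y
        using le[OF that] True by (simp add: A_def pos_divide_le_eq mult.commute)
      have "(\<Sum>y\<in>UNIV. p x y * A x y) = divergence_at \<alpha> x / L" for x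
        by (simp add: A_def divergence_at_def sum_divide_distrib)
      moreover have "divergence_at \<alpha> x = divergence_at \<alpha> a" for x
        using \<alpha> by (simp add: harmonic_forms_def)
      ultimately show "(\<Sum>y\<in>UNIV. p x y * A x y) = divergence_at \<alpha> a / L" for x by simp
    qed
    have "A a b = d b a" using ab True dpos[OF ab(1)] d_sym[of a b] by (simp add: A_def field_simps)
    then have "b \<in> tails" using adj_sym[OF ab(1)] by (auto simp: tails_def)
    then have "x0 \<in> tails" using tails_eq_UNIV by blast
    then obtain y where y: "adj p x0 y" "A y x0 = d x0 y" by (auto simp: tails_def)
    then have "L * d y x0 = \<alpha> $ y $ x0" using True d_sym[of y x0] by (simp add: A_def field_simps)
    also have "\<dots> \<le> m * d y x0" using m adj_sym[OF y(1)] .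
    finally show ?thesis using dpos[OF adj_sym[OF y(1)]] by simp
  next
    case False
    \<comment> \<open>If \<open>L \<le> 0\<close>, antisymmetry makes the slopes into
      \<open>x0\<close> non-negative; a neighbour of \<open>x0\<close> then yields
      \<open>0 \<le> m\<close>.\<close>
    have "\<exists>y. adj p x0 y"
    proof (rule ccontr)
      assume "\<not> ?thesis"
      then have "w \<in> {x0}" for w using adj_closed_UNIV[of x0 "{x0}" w] by blast
      then have "u = v" by (metis singletonD)
      then show False using uv by simp
    qed
    then obtain y where y: "adj p x0 y" by blast
    have "0 \<le> - (L * d x0 y)" using False dpos[OF y] by (simp add: mult_nonpos_nonneg)
    also have "\<dots> \<le> \<alpha> $ y $ x0" using le[OF y] anti[of x0 y] by simp
    also have "\<dots> \<le> m * d y x0" using m adj_sym[OF y] .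
    finally have "0 \<le> m" using dpos[OF adj_sym[OF y]] by (simp add: zero_le_mult_iff)
    then show ?thesis using False by simp
  qed
  then have "L * d u v \<le> m * d u v" using d_nonneg by (intro mult_right_mono)
  then show ?thesis using le[OF uv] by simp
qed

text \<open>The functionals are the slopes of the edges into \<open>x0\<close>. A bound on them
  bounds the slopes of all edges, in particular of the reversed ones, which gives the symmetry; the
  bound zero forces the form to vanish.\<close>

lemma dim_harmonic_forms_le: "2 * dim harmonic_forms \<le> vertex_degree p x0"
  unfolding vertex_degree_def
proof (rule dim_le_half_card_if_symmetric[OF subspace_harmonic_forms])
  define w :: "'a \<Rightarrow> real^'a^'a" where "w y = axis y (axis x0 (1 / d y x0))" for y
  have w: "w y \<bullet> \<alpha> = \<alpha> $ y $ x0 / d y x0" for y \<alpha> by (simp add: w_def inner_axis')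
  have anti: "\<alpha> $ x $ y = - \<alpha> $ y $ x" if "\<alpha> \<in> harmonic_forms" for \<alpha> x y
    using that unfolding harmonic_forms_def ker_delta1_def one_forms_def by blast
  have slope: "\<alpha> $ u $ v \<le> m * d u v"
    if "\<alpha> \<in> harmonic_forms" "\<And>y. y \<in> {y. adj p y x0} \<Longrightarrow> w y \<bullet> \<alpha> \<le> m" "adj p u v" for \<alpha> m u v
  proof (rule harmonic_form_max_slope[OF that(1) _ that(3)])
    fix y assume y: "adj p y x0"
    then show "\<alpha> $ y $ x0 \<le> m * d y x0"
      using that(2)[of y] d_pos[of y x0] by (auto simp: w adj_def pos_divide_le_eq)
  qed
  show "- m \<le> w y \<bullet> \<alpha>"
    if "\<alpha> \<in> harmonic_forms" "\<And>y. y \<in> {y. adj p y x0} \<Longrightarrow> w y \<bullet> \<alpha> \<le> m" "y \<in> {y. adj p y x0}" for \<alpha> m y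
  proof -
    have "\<alpha> $ x0 $ y \<le> m * d x0 y" using slope[OF that(1,2)] that(3) adj_sym by blast
    then show ?thesis
      using anti[OF that(1), of x0 y] d_pos[of y x0] d_sym[of y x0] that(3)
      by (auto simp: w adj_def pos_le_divide_eq)
  qed
  show "\<alpha> = 0" if "\<alpha> \<in> harmonic_forms" "\<And>y. y \<in> {y. adj p y x0} \<Longrightarrow> w y \<bullet> \<alpha> = 0" for \<alpha>
  proof -
    have le: "\<alpha> $ u $ v \<le> 0" if "adj p u v" for u v
      using slope[OF \<open>\<alpha> \<in> harmonic_forms\<close>, of 0 u v] that \<open>\<And>y. y \<in> {y. adj p y x0} \<Longrightarrow> w y \<bullet> \<alpha> = 0\<close> by simp
    have "\<alpha> $ u $ v = 0" for u v
    proof (cases "adj p u v")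
      case True
      then show ?thesis using le[OF True] le[OF adj_sym[OF True]] anti[OF that(1), of u v] by simp
    next
      case False
      then show ?thesis
        using that(1) unfolding harmonic_forms_def ker_delta1_def one_forms_def by blast
    qed
    then show ?thesis by (simp add: vec_eq_iff)
  qed
qed simp

end

theorem theorem4p20:
  fixes p d :: "'a::finite \<Rightarrow> 'a \<Rightarrow> real"
  assumes "markov_chain p"
    and "irreducible_chain p"
    and "symmetric_support p"
    and "path_distance p d"
    and "nonneg_ollivier_curvature p d"
  shows "real (betti1 p d) \<le> real (min_degree p) / 2"
proof -
  interpret nonneg_curved p d using assms by unfold_locales
  have "min_degree p \<in> range (vertex_degree p)" unfolding min_degree_def by (intro Min_in) auto
  then obtain x0 where "min_degree p = vertex_degree p x0" by auto
  then have "2 * betti1 p d \<le> min_degree p"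
    using betti1_le_dim_harmonic dim_harmonic_forms_le[of x0] by linarith
  then show ?thesis by simp
qed

end
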